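(* Let $m\ge n\ge 0$ be integers and let $\lambda$ be a partition inside an $n\times m$ board (at most $n$ parts, each at most $m$). Then $$X_\lambda({\bf x},q)=\frac{1}{[m]_n}\sum_{j=0}^{n} H_j^{m,n}(\lambda)\, X_{m^j}({\bf x},q),$$ where $X_\lambda({\bf x},q)$ and $X_{m^j}({\bf x},q)$ are the chromatic quasisymmetric functions of the graphs on $m+n$ vertices associated with $\lambda$ and with the rectangle $m^j$ ($j$ rows of length $m$), and $H_j^{m,n}(\lambda)$ are the $q$-hit numbers of $\lambda$ in the $n\times m$ board.
   Context: $q$-notation: $[x]=(1-q^x)/(1-q)$, $[a]_k=[a][a-1]\cdots[a-k+1]$, $[a]!=[a]_a$, and $(x;q)_k=\prod_{i=0}^{k-1}(1-xq^i)$; $q$ is an indeterminate. Boards and partitions: an $n\times m$ board has $n$ rows and $m$ columns; cell $(i,j)$ is in row $i$ from the top and column $j$ from the left. A partition $\lambda=(\lambda_1\ge\lambda_2\ge\cdots\ge\lambda_n\ge 0)$ with $\lambda_1\le m$ is identified with the set of cells $(i,j)$ with $j\le\lambda_i$; $|\lambda|$ is its number of cells. Graph of $\lambda$: $G(\lambda)$ has vertices $1,\dots,m+n$; all pairs $a<b$ are edges except those with $a\le m<b$ and $a\le\lambda_{m+n+1-b}$ (i.e. cell $(i,a)\in\lambda$ corresponds to the non-edge $\{a,m+n+1-i\}$). This is the graph whose edges correspond to the cells under the abelian Dyck path $\mathsf{n}^m w(\lambda)\mathsf{e}^n$. Chromatic quasisymmetric function: $X_\lambda({\bf x},q)=\sum_\kappa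 q^{\mathrm{asc}(\kappa)}\prod_{v}x_{\kappa(v)}$, the sum over proper colorings $\kappa:\{1,\dots,m+n\}\to\{1,2,3,\dots\}$ of $G(\lambda)$, where $\mathrm{asc}(\kappa)$ is the number of edges $\{a,b\}$ with $a<b$ and $\kappa(a)<\kappa(b)$. $q$-rook numbers: $R_k(\lambda)=\sum_p q^{\mathrm{inv}(p)}$ over all placements $p$ of $k$ non-attacking rooks on cells of $\lambda$ (no two in the same row or column), where $\mathrm{inv}(p)$ is the number of cells of $\lambda$ left after each rook cancels its own cell, the cells of $\lambda$ North of it in its column, and the cells West of it in its row. $q$-hit numbers: for $\lambda$ inside an $n\times m$ board with $n\le m$, the $H_i^{m,n}(\lambda)$ are defined by $$\sum_{i=0}^n H_i^{m,n}(\lambda)x^i=\frac{q^{-|\lambda|}}{[m-n]!}\sum_{i=0}^n R_i(\lambda)\,[m-i]!\,(-1)^i q^{mi-\binom i2}(x;q)_i .$$ *)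

theory Defs
  imports
    "HOL-Computational_Algebra.Computational_Algebra"
    "HOL-Library.Multiset"
    "HOL-Library.FuncSet"
begin

(* The indeterminate q, as an element of the field of rational functions Q(q). The notions
   below take q as a parameter ranging over an arbitrary field; the divisions in qnum and qhit_poly
   are meaningful when q is neither 0 nor a root of unity, in particular for qvar. *)

definition qvar :: "rat poly fract" where
  "qvar = to_fract [:0, 1:]"

definition qnum :: "'a::field \<Rightarrow> nat \<Rightarrow> 'a" where
  "qnum q x = (1 - q ^ x) / (1 - q)"

(* [a]_k; intended for k at most a, as the subtraction on nat truncates. *)
definition qfalling :: "'a::field \<Rightarrow> nat \<Rightarrow> nat \<Rightarrow> 'a" where
  "qfalling q a k = (\<Prod>i<k. qnum q (a - i))"

definition qfactorial :: "'a::field \<Rightarrow> nat \<Rightarrow> 'a" where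
  "qfactorial q a = qfalling q a a"

definition qpochhammer :: "'a::comm_ring_1 \<Rightarrow> 'a \<Rightarrow> nat \<Rightarrow> 'a" where
  "qpochhammer x q k = (\<Prod>i<k. 1 - x * q ^ i)"


(* A partition with at most n parts is a function whose values at 1, ..., n are the
   parts lam_1, ..., lam_n; values at other arguments are irrelevant. *)

definition partition_in_board :: "nat \<Rightarrow> nat \<Rightarrow> (nat \<Rightarrow> nat) \<Rightarrow> bool" where
  "partition_in_board m n lam \<longleftrightarrow>
     (\<forall>i\<in>{1..n}. \<forall>j\<in>{1..n}. i \<le> j \<longrightarrow> lam j \<le> lam i) \<and> (\<forall>i\<in>{1..n}. lam i \<le> m)"

definition rectangle :: "nat \<Rightarrow> nat \<Rightarrow> nat \<Rightarrow> nat" where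
  "rectangle m j = (\<lambda>i. if i \<le> j then m else 0)"

definition cells :: "nat \<Rightarrow> (nat \<Rightarrow> nat) \<Rightarrow> (nat \<times> nat) set" where
  "cells n lam = {(i, j). 1 \<le> i \<and> i \<le> n \<and> 1 \<le> j \<and> j \<le> lam i}"


(* Edges are recorded as pairs (a, b) with a < b. *)
definition graph_edges :: "nat \<Rightarrow> nat \<Rightarrow> (nat \<Rightarrow> nat) \<Rightarrow> (nat \<times> nat) set" where
  "graph_edges m n lam =
     {(a, b). 1 \<le> a \<and> a < b \<and> b \<le> m + n \<and>
              \<not> (a \<le> m \<and> m < b \<and> a \<le> lam (m + n + 1 - b))}"

definition proper_colorings :: "nat \<Rightarrow> nat \<Rightarrow> (nat \<Rightarrow> nat) \<Rightarrow> (nat \<Rightarrow> nat) set" where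
  "proper_colorings m n lam =
     {\<kappa> \<in> {1..m + n} \<rightarrow>\<^sub>E {1..}. \<forall>(a, b)\<in>graph_edges m n lam. \<kappa> a \<noteq> \<kappa> b}"

definition asc :: "nat \<Rightarrow> nat \<Rightarrow> (nat \<Rightarrow> nat) \<Rightarrow> (nat \<Rightarrow> nat) \<Rightarrow> nat" where
  "asc m n lam \<kappa> = card {(a, b) \<in> graph_edges m n lam. \<kappa> a < \<kappa> b}"

(* A monomial in the variables x_1, x_2, ... is the multiset of the indices of its factors,
   and a formal power series in these variables is the function assigning to each monomial
   its coefficient. *)
type_synonym 'a mseries = "nat multiset \<Rightarrow> 'a"

(* The product of the x_(kappa v) over all vertices v *)
definition coloring_monomial :: "nat \<Rightarrow> nat \<Rightarrow> (nat \<Rightarrow> nat) \<Rightarrow> nat multiset" where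
  "coloring_monomial m n \<kappa> = image_mset \<kappa> (mset_set {1..m + n})"

(* The formal sum over all proper colorings, collected by monomials: only finitely many
   colorings contribute to each coefficient, see finite_colorings_of_monomial. *)
definition chromatic_qsym :: "'a::field \<Rightarrow> nat \<Rightarrow> nat \<Rightarrow> (nat \<Rightarrow> nat) \<Rightarrow> 'a mseries" where
  "chromatic_qsym q m n lam =
     (\<lambda>M. \<Sum>\<kappa> | \<kappa> \<in> proper_colorings m n lam \<and> coloring_monomial m n \<kappa> = M.
            q ^ asc m n lam \<kappa>)"

lemma finite_colorings_of_monomial:
  "finite {\<kappa> \<in> proper_colorings m n lam. coloring_monomial m n \<kappa> = M}"
proof (rule finite_subset)
  show "{\<kappa> \<in> proper_colorings m n lam. coloring_monomial m n \<kappa> = M}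
          \<subseteq> {1..m + n} \<rightarrow>\<^sub>E set_mset M"
    by (auto simp: proper_colorings_def coloring_monomial_def PiE_iff extensional_def)
  show "finite ({1..m + n} \<rightarrow>\<^sub>E set_mset M)"
    by (intro finite_PiE) auto
qed


definition rook_placements :: "nat \<Rightarrow> (nat \<Rightarrow> nat) \<Rightarrow> nat \<Rightarrow> (nat \<times> nat) set set" where
  "rook_placements n lam k =
     {p. p \<subseteq> cells n lam \<and> card p = k \<and>
         (\<forall>(i, j)\<in>p. \<forall>(i', j')\<in>p. (i, j) \<noteq> (i', j') \<longrightarrow> i \<noteq> i' \<and> j \<noteq> j')}"

(* The rook (r, s) cancels the cells (i, s) with i <= r, that is, its own cell and those
   North of it, and the cells (r, j) with j <= s, that is, its own cell and those West of it. *)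
definition rook_inv :: "nat \<Rightarrow> (nat \<Rightarrow> nat) \<Rightarrow> (nat \<times> nat) set \<Rightarrow> nat" where
  "rook_inv n lam p =
     card {(i, j) \<in> cells n lam. \<not> (\<exists>(r, s)\<in>p. (j = s \<and> i \<le> r) \<or> (i = r \<and> j \<le> s))}"

definition qrook :: "'a::field \<Rightarrow> nat \<Rightarrow> (nat \<Rightarrow> nat) \<Rightarrow> nat \<Rightarrow> 'a" where
  "qrook q n lam k = (\<Sum>p\<in>rook_placements n lam k. q ^ rook_inv n lam p)"

(* The generating polynomial, in x, of the q-hit numbers: here x is [:0, 1:] and the
   scalar q is the constant polynomial [:q:]. Intended for n at most m. *)
definition qhit_poly :: "'a::field \<Rightarrow> nat \<Rightarrow> nat \<Rightarrow> (nat \<Rightarrow> nat) \<Rightarrow> 'a poly" where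
  "qhit_poly q m n lam =
     smult (q powi (- int (card (cells n lam))) / qfactorial q (m - n))
       (\<Sum>i = 0..n.
          smult (qrook q n lam i * qfactorial q (m - i) * (- 1) ^ i *
                 q powi (int (m * i) - int (i choose 2)))
            (qpochhammer [:0, 1:] [:q:] i))"

definition qhit :: "'a::field \<Rightarrow> nat \<Rightarrow> nat \<Rightarrow> (nat \<Rightarrow> nat) \<Rightarrow> nat \<Rightarrow> 'a" where
  "qhit q m n lam i = coeff (qhit_poly q m n lam) i"

end

theory Submission
  imports Defs
begin

text \<open>
  Put \<open>P\<^bsub>\<lambda>\<^esub>(u) = (\<Prod>i=1..n. q^(-\<lambda>\<^sub>i) - u q^i)\<close>. The proof compares both sides of the expansion with this
  polynomial.

  The colouring side: every coefficient of \<open>X\<^bsub>\<lambda>\<^esub>\<close> is the value at \<open>P\<^bsub>\<lambda>\<^esub>\<close> of a linear functional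
  that depends on \<open>m\<close>, \<open>n\<close> and the monomial, but not on \<open>\<lambda>\<close>
  (\<open>coloring_sum_linear_in_board_prod\<close>). Indeed, the graph of \<open>\<lambda>\<close> consists of two cliques, the
  columns and the rows of the board, and the vertices of least colour form an independent set: a
  column, a row, or a row and a column that meet in a cell of \<open>\<lambda>\<close>. Deleting them leaves a graph of
  the same kind. Hence a coefficient of \<open>X\<^bsub>\<lambda>\<^esub>\<close> is a weighted sum of coefficients for the boards
  with a column, a row, or a cell's row and column deleted. With these weights, the sums of the
  polynomials of the smaller boards telescope to combinations of \<open>P\<^bsub>\<lambda>\<^esub>(u)\<close>, \<open>P\<^bsub>\<lambda>\<^esub>(u/q)\<close> and
  \<open>P\<^bsub>\<lambda>\<^esub>(u/q\<^sup>2)\<close> whose coefficients do not depend on \<open>\<lambda>\<close> (\<open>sum_board_prod_remove_row\<close>,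
  \<open>sum_board_prod_remove_column\<close>, \<open>sum_board_prod_remove_cell\<close>), so linearity passes from the
  smaller boards to the given one. Only the values of \<open>P\<^bsub>\<lambda>\<^esub>\<close> at the points \<open>u = q^(-t)\<close> are used, and
  replacing \<open>u\<close> by \<open>u/q\<close> shifts \<open>t\<close> by one; at these points \<open>u \<noteq> 0\<close>, so the division by \<open>u\<close> that the
  sum over deleted rows involves is harmless.

  The rook side: it remains to show that
  \<open>[m]\<^sub>n P\<^bsub>\<lambda>\<^esub>(u) = (\<Sum>j\<le>n. H\<^sub>j(\<lambda>) P\<^bsub>m^j\<^esub>(u))\<close> (\<open>sum_qhit_rectangles\<close>). By the q-analogue of the
  factorization theorem of Goldman, Joichi and White, \<open>P\<^bsub>\<lambda>\<^esub>(u)\<close> is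
  \<open>q^(-|\<lambda>|)\<close> times the sum of \<open>R\<^sub>k(\<lambda>) (1 - q)^k (\<Prod>i=k+1..n. 1 - u q^i)\<close> over \<open>k\<close>
  (\<open>rook_factorization\<close>). On the other hand, replacing each \<open>x^j\<close> in \<open>(x;q)\<^sub>i\<close> by \<open>P\<^bsub>m^j\<^esub>(u)\<close>
  gives a product (\<open>qpochhammer_evaluation_board\<close>), and inserting it into the definition of the
  q-hit numbers yields the same sum.
\<close>

section \<open>Sums over the rows and columns of a board\<close>

lemma qnum_0 [simp]: "qnum q 0 = 0"
  by (simp add: qnum_def)

lemma qnum_Suc:
  assumes "q \<noteq> 1"
  shows "qnum q (Suc k) = qnum q k + q ^ k"
  using assms by (simp add: qnum_def field_simps)

lemma sum_power_card_greater:
  fixes A :: "nat set"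
  assumes "finite A" "q \<noteq> (1 :: 'a :: field)"
  shows "(\<Sum>a\<in>A. q ^ card {x \<in> A. a < x}) = qnum q (card A)"
  using assms(1)
proof (induction A rule: finite_linorder_min_induct)
  case (insert b A)
  have b: "b \<notin> A" and eq: "{x. (x = b \<or> x \<in> A) \<and> b < x} = A"
    using insert by auto
  have "{x. (x = b \<or> x \<in> A) \<and> a < x} = {x \<in> A. a < x}" if "a \<in> A" for a
    using insert that by (auto dest: order.strict_trans)
  then show ?case
    using insert b assms(2) by (simp add: eq qnum_Suc)
qed simp

text \<open>
  The initial segment of \<open>A\<close> cut out by the downward closed predicate \<open>Q\<close>.
\<close>

lemma sum_power_card_greater_initial:
  fixes A :: "nat set"
  assumes "finite A" "q \<noteq> (1 :: 'a :: field)" "\<And>a x. Q x \<Longrightarrow> a \<le> x \<Longrightarrow> Q a"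
  shows "(\<Sum>a | a \<in> A \<and> Q a. q ^ card {x \<in> A. a < x}) =
           q ^ card {a \<in> A. \<not> Q a} * qnum q (card {a \<in> A. Q a})"
proof -
  have "card {x \<in> A. a < x} = card {x \<in> {a \<in> A. Q a}. a < x} + card {x \<in> A. \<not> Q x}"
    if "Q a" for a
  proof -
    have "{x \<in> A. a < x} = {x \<in> {a \<in> A. Q a}. a < x} \<union> {x \<in> A. \<not> Q x}"
      using that assms(3) by (auto simp flip: not_le)
    then show ?thesis
      using assms(1) by (simp only:) (subst card_Un_disjoint; auto)
  qed
  then have "(\<Sum>a | a \<in> A \<and> Q a. q ^ card {x \<in> A. a < x}) =
        (\<Sum>a | a \<in> A \<and> Q a. q ^ card {a \<in> A. \<not> Q a} * q ^ card {x \<in> {a \<in> A. Q a}. a < x})"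
    by (intro sum.cong) (auto simp: power_add)
  also have "\<dots> = q ^ card {a \<in> A. \<not> Q a} * qnum q (card {a \<in> A. Q a})"
    using sum_power_card_greater[of "{a \<in> A. Q a}" q] assms by (simp flip: sum_distrib_left)
  finally show ?thesis .
qed

text \<open>
  The product over the rows \<open>b \<in> B\<close> of \<open>v b - w b * q ^ r\<close>, where \<open>r\<close> is the rank of \<open>b\<close> in \<open>B\<close>,
  the largest element having rank 1. The evaluation point \<open>w b\<close> may vary with the row, since
  deleting a column shifts it from \<open>u\<close> to \<open>u / q\<close> exactly in the rows that meet that column.
\<close>

definition mix_prod :: "'a::field \<Rightarrow> nat set \<Rightarrow> (nat \<Rightarrow> 'a) \<Rightarrow> (nat \<Rightarrow> 'a) \<Rightarrow> 'a" where
  "mix_prod q B v w = (\<Prod>b\<in>B. v b - w b * q ^ card {x \<in> B. b \<le> x})"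

lemma mix_prod_empty [simp]: "mix_prod q {} v w = 1"
  by (simp add: mix_prod_def)

lemma mix_prod_cong:
  assumes "\<And>b. b \<in> B \<Longrightarrow> v b = v' b" "\<And>b. b \<in> B \<Longrightarrow> w b = w' b"
  shows "mix_prod q B v w = mix_prod q B v' w'"
  using assms by (simp add: mix_prod_def cong: prod.cong)

lemma mix_prod_insert:
  assumes "finite B" "\<forall>b\<in>B. b0 < b"
  shows "mix_prod q (insert b0 B) v w = (v b0 - w b0 * q ^ Suc (card B)) * mix_prod q B v w"
proof -
  have b0: "b0 \<notin> B" and eq: "{x. (x = b0 \<or> x \<in> B) \<and> b0 \<le> x} = insert b0 B"
    using assms by (auto intro: less_imp_le)
  have "{x. (x = b0 \<or> x \<in> B) \<and> b \<le> x} = {x \<in> B. b \<le> x}" if "b \<in> B" for b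
    using that assms by auto
  then show ?thesis
    using assms(1) b0 by (simp add: mix_prod_def eq)
qed

text \<open>
  Deleting a row lowers the ranks of the smaller rows by one, which for them amounts to replacing
  \<open>u\<close> by \<open>u / q\<close>. The sum over the deleted row therefore telescopes. The predicate \<open>Q\<close> restricts the
  sum to an upward closed set of rows, those that meet a given column.
\<close>

lemma sum_mix_prod_remove:
  assumes "finite B" "q \<noteq> (0 :: 'a :: field)"
    "\<And>b b'. b \<in> B \<Longrightarrow> b' \<in> B \<Longrightarrow> b \<le> b' \<Longrightarrow> Q b \<Longrightarrow> Q b'"
  shows "u * (1 - q) * (\<Sum>b | b \<in> B \<and> Q b. q ^ card {x \<in> B. b < x} * mix_prod q (B - {b}) v (\<lambda>_. u)) =
         mix_prod q B v (\<lambda>b. if Q b then u else u / q) - mix_prod q B v (\<lambda>_. u / q)"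
  using assms(1,3)
proof (induction B rule: finite_linorder_min_induct)
  case (insert b0 B)
  have b0: "b0 \<notin> B" using insert by auto
  define S where "S = (\<Sum>b | b \<in> B \<and> Q b. q ^ card {x \<in> B. b < x} * mix_prod q (B - {b}) v (\<lambda>_. u))"
  define R where "R = (v b0 - u * q ^ card B) * S"
  have IH: "u * (1 - q) * S =
      mix_prod q B v (\<lambda>b. if Q b then u else u / q) - mix_prod q B v (\<lambda>_. u / q)"
    unfolding S_def by (rule insert.IH) (use insert.prems in auto)
  have *: "q ^ card {x \<in> insert b0 B. b < x} * mix_prod q (insert b0 B - {b}) v (\<lambda>_. u) =
       (v b0 - u * q ^ card B) * (q ^ card {x \<in> B. b < x} * mix_prod q (B - {b}) v (\<lambda>_. u))"
    if "b \<in> B" for b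
  proof -
    have "insert b0 B - {b} = insert b0 (B - {b})" using that b0 by auto
    moreover have "{x \<in> insert b0 B. b < x} = {x \<in> B. b < x}"
      using that insert.hyps by auto
    moreover have "Suc (card (B - {b})) = card B"
      using that insert.hyps by (intro card_Suc_Diff1)
    ultimately show ?thesis
      using insert.hyps by (simp add: mix_prod_insert del: power_Suc card_Diff_insert)
  qed
  have R: "(\<Sum>b | b \<in> B \<and> Q b. q ^ card {x \<in> insert b0 B. b < x} *
               mix_prod q (insert b0 B - {b}) v (\<lambda>_. u)) = R"
    unfolding R_def S_def sum_distrib_left by (intro sum.cong refl, rule *) auto
  show ?case
  proof (cases "Q b0")
    case True
    \<comment> \<open>The least row satisfies the upward closed predicate, so all rows do.\<close>
    then have all: "Q b" if "b \<in> B" for b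
      using insert.prems[of b0 b] that insert.hyps by auto
    have eq1: "{b. b \<in> insert b0 B \<and> Q b} = insert b0 {b. b \<in> B \<and> Q b}"
      using True by auto
    have eq2: "{x \<in> insert b0 B. b0 < x} = B" "insert b0 B - {b0} = B"
      using insert.hyps b0 by auto
    have eq3: "mix_prod q B v (\<lambda>b. if Q b then u else u / q) = mix_prod q B v (\<lambda>_. u)"
      by (intro mix_prod_cong) (auto simp: all)
    have sum_eq: "(\<Sum>b | b \<in> insert b0 B \<and> Q b. q ^ card {x \<in> insert b0 B. b < x} *
             mix_prod q (insert b0 B - {b}) v (\<lambda>_. u)) = q ^ card B * mix_prod q B v (\<lambda>_. u) + R"
      unfolding eq1 by (subst sum.insert; (simp only: eq2 R | use insert.hyps(1) b0 in simp))
    have "u * (1 - q) * (\<Sum>b | b \<in> insert b0 B \<and> Q b. q ^ card {x \<in> insert b0 B. b < x} *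
             mix_prod q (insert b0 B - {b}) v (\<lambda>_. u)) =
          u * (1 - q) * q ^ card B * mix_prod q B v (\<lambda>_. u) + (v b0 - u * q ^ card B) * (u * (1 - q) * S)"
      by (simp only: sum_eq) (simp add: R_def algebra_simps)
    also have "(v b0 - u * q ^ card B) * (u * (1 - q) * S) =
        (v b0 - u * q ^ card B) * (mix_prod q B v (\<lambda>_. u) - mix_prod q B v (\<lambda>_. u / q))"
      by (simp only: IH eq3)
    finally show ?thesis
      using insert.hyps True assms(2)
      by (simp add: mix_prod_insert eq3) (simp add: algebra_simps)
  next
    case False
    then have eq1: "{b. b \<in> insert b0 B \<and> Q b} = {b. b \<in> B \<and> Q b}"
      by auto
    have "u * (1 - q) * R = (v b0 - u * q ^ card B) * (u * (1 - q) * S)"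
      by (simp add: R_def)
    also have "\<dots> = (v b0 - u * q ^ card B) *
        (mix_prod q B v (\<lambda>b. if Q b then u else u / q) - mix_prod q B v (\<lambda>_. u / q))"
      by (simp only: IH)
    finally show ?thesis
      unfolding eq1 R using insert.hyps False assms(2)
      by (simp add: mix_prod_insert) (simp add: algebra_simps)
  qed
qed simp

text \<open>
  The polynomial of a board, evaluated at \<open>u\<close>. Here \<open>A\<close> is the set of columns, \<open>B\<close> the set of rows,
  and row \<open>b\<close> consists of the columns \<open>a \<in> A\<close> with \<open>a \<le> \<mu> b\<close>. The rows are labelled by the vertices
  of the graph, so the top row carries the largest label and \<open>\<mu>\<close> is weakly increasing. Arbitrary
  finite sets \<open>A\<close> and \<open>B\<close> are allowed because the induction deletes rows and columns without
  relabelling the others.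
\<close>

definition board_prod :: "'a::field \<Rightarrow> nat set \<Rightarrow> nat set \<Rightarrow> (nat \<Rightarrow> nat) \<Rightarrow> 'a \<Rightarrow> 'a" where
  "board_prod q A B \<mu> u =
     mix_prod q B (\<lambda>b. inverse q ^ card {a \<in> A. a \<le> \<mu> b}) (\<lambda>_. u)"

text \<open>
  The column analogue of \<open>sum_mix_prod_remove\<close>. The summand belonging to \<open>a\<close> is, up to a power of
  \<open>q\<close>, the product of the board without column \<open>a\<close> (see \<open>mix_prod_remove_column\<close>). The proof adds
  the rows from the top, so that the row \<open>b0\<close> added last is the shortest one.
\<close>

lemma sum_mix_prod_column:
  fixes q u :: "'a::field"
  assumes "finite A" "finite B" "q \<noteq> 0" "q \<noteq> 1" "mono_on B \<mu>"
  shows "(1 - q) * (\<Sum>a\<in>A. q ^ card {x \<in> A. a < x} *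
            mix_prod q B (\<lambda>b. inverse q ^ card {a \<in> A. a \<le> \<mu> b}) (\<lambda>b. if a \<le> \<mu> b then u / q else u)) =
         (1 - u * q ^ card A) * board_prod q A B \<mu> u -
           q ^ card A * (1 - u * q ^ card B) * board_prod q A B \<mu> (u / q)"
  using assms(2,5)
proof (induction B rule: finite_linorder_min_induct)
  case empty
  show ?case
    using sum_power_card_greater[of A q] assms
    by (simp add: board_prod_def qnum_def) (simp add: algebra_simps)
next
  case (insert b0 B)
  define v where "v = (\<lambda>b. inverse q ^ card {a \<in> A. a \<le> \<mu> b})"
  define T where "T = (\<lambda>a. mix_prod q B v (\<lambda>b. if a \<le> \<mu> b then u / q else u))"
  define P where "P = mix_prod q B v (\<lambda>_. u)"
  define P' where "P' = mix_prod q B v (\<lambda>_. u / q)"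
  define k where "k = card {a \<in> A. a \<le> \<mu> b0}"
  define l where "l = card {a \<in> A. \<not> a \<le> \<mu> b0}"
  define n where "n = card B"
  have cA: "card A = k + l"
  proof -
    have "A = {a \<in> A. a \<le> \<mu> b0} \<union> {a \<in> A. \<not> a \<le> \<mu> b0}" by auto
    then show ?thesis
      unfolding k_def l_def using assms(1) by (subst card_Un_disjoint[symmetric]) auto
  qed
  have vb: "v b0 = inverse q ^ k" by (simp add: v_def k_def)
  have mono: "mono_on B \<mu>" using insert.prems by (auto simp: monotone_on_def)
  have IH: "(1 - q) * (\<Sum>a\<in>A. q ^ card {x \<in> A. a < x} * T a) =
      (1 - u * q ^ card A) * P - q ^ card A * (1 - u * q ^ n) * P'"
    using insert.IH[OF mono] unfolding board_prod_def v_def[symmetric] T_def P_def P'_def n_def .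
  \<comment> \<open>A column that meets the shortest row meets all rows.\<close>
  have T: "T a = P'" if "a \<le> \<mu> b0" for a
    unfolding T_def P'_def
  proof (rule mix_prod_cong)
    fix b assume "b \<in> B"
    then have "\<mu> b0 \<le> \<mu> b"
      using insert.prems insert.hyps by (auto simp: monotone_on_def less_imp_le)
    then show "(if a \<le> \<mu> b then u / q else u) = u / q" using that by simp
  qed simp
  have term_eq: "mix_prod q (insert b0 B) v (\<lambda>b. if a \<le> \<mu> b then u / q else u) =
      (v b0 - u * q ^ Suc n) * T a + (if a \<le> \<mu> b0 then u * q ^ n * (q - 1) * P' else 0)" for a
  proof -
    have "mix_prod q (insert b0 B) v (\<lambda>b. if a \<le> \<mu> b then u / q else u) =
        (v b0 - (if a \<le> \<mu> b0 then u / q else u) * q ^ Suc n) * T a"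
      using insert.hyps unfolding T_def n_def by (subst mix_prod_insert) auto
    then show ?thesis
      using assms(3) T[of a] by (simp only:) (simp add: algebra_simps)
  qed
  have "(\<Sum>a\<in>A. q ^ card {x \<in> A. a < x} * (if a \<le> \<mu> b0 then u * q ^ n * (q - 1) * P' else 0)) =
        (\<Sum>a | a \<in> A \<and> a \<le> \<mu> b0. q ^ card {x \<in> A. a < x}) * (u * q ^ n * (q - 1) * P')"
    unfolding sum_distrib_right using assms(1)
    by (intro sum.mono_neutral_cong_right) auto
  also have "\<dots> = q ^ l * qnum q k * (u * q ^ n * (q - 1) * P')"
    using assms by (subst sum_power_card_greater_initial) (auto simp: k_def l_def)
  finally have "(1 - q) * (\<Sum>a\<in>A. q ^ card {x \<in> A. a < x} *
          mix_prod q (insert b0 B) v (\<lambda>b. if a \<le> \<mu> b then u / q else u)) =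
        (v b0 - u * q ^ Suc n) * ((1 - q) * (\<Sum>a\<in>A. q ^ card {x \<in> A. a < x} * T a)) +
        (1 - q) * (q ^ l * qnum q k * (u * q ^ n * (q - 1) * P'))"
    unfolding term_eq distrib_left sum.distrib by (simp add: sum_distrib_left mult_ac)
  also have "(1 - q) * (q ^ l * qnum q k * (u * q ^ n * (q - 1) * P')) =
      q ^ l * (1 - q ^ k) * (u * q ^ n * (q - 1) * P')"
    using assms(4) by (simp add: qnum_def)
  also have "(v b0 - u * q ^ Suc n) * ((1 - q) * (\<Sum>a\<in>A. q ^ card {x \<in> A. a < x} * T a)) + \<dots> =
      (1 - u * q ^ card A) * ((v b0 - u * q ^ Suc n) * P) -
      q ^ card A * (1 - u * q ^ Suc n) * ((v b0 - u / q * q ^ Suc n) * P')"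
    unfolding IH vb cA using assms(3) by (simp add: field_simps power_add)
  finally show ?case
    using insert.hyps unfolding board_prod_def v_def[symmetric]
    by (simp add: mix_prod_insert n_def[symmetric] P_def[symmetric] P'_def[symmetric]
          card_insert_if[OF insert.hyps(1)] del: power_Suc) (use insert.hyps in auto)
qed

text \<open>
  Each row that meets column \<open>a\<close> becomes shorter by one. This multiplies \<open>q^(-length)\<close> by \<open>q\<close>, and
  \<open>q\<close> can be taken out of the factor at the cost of dividing the evaluation point by \<open>q\<close>.
\<close>

lemma mix_prod_remove_column:
  fixes q :: "'a::field"
  assumes "finite A" "finite B" "q \<noteq> 0" "a \<in> A"
  shows "mix_prod q B (\<lambda>b. inverse q ^ card {x \<in> A - {a}. x \<le> \<mu> b}) w =
     q ^ card {b \<in> B. a \<le> \<mu> b} *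
     mix_prod q B (\<lambda>b. inverse q ^ card {x \<in> A. x \<le> \<mu> b}) (\<lambda>b. if a \<le> \<mu> b then w b / q else w b)"
proof -
  have *: "inverse q ^ card {x \<in> A - {a}. x \<le> \<mu> b} - w b * r =
      (if a \<le> \<mu> b then q else 1) *
        (inverse q ^ card {x \<in> A. x \<le> \<mu> b} - (if a \<le> \<mu> b then w b / q else w b) * r)" for b r
  proof (cases "a \<le> \<mu> b")
    case True
    have "{x \<in> A. x \<le> \<mu> b} = insert a {x \<in> A - {a}. x \<le> \<mu> b}"
      using True assms(4) by auto
    then have "card {x \<in> A. x \<le> \<mu> b} = Suc (card {x \<in> A - {a}. x \<le> \<mu> b})"
      using assms(1) by simp
    then show ?thesis
      using True assms(3) by (simp add: field_simps)
  next
    case False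
    then have "{x \<in> A - {a}. x \<le> \<mu> b} = {x \<in> A. x \<le> \<mu> b}" by auto
    then show ?thesis using False by simp
  qed
  have "(\<Prod>b\<in>B. if a \<le> \<mu> b then q else 1) = q ^ card {b \<in> B. a \<le> \<mu> b}"
    using assms(2) by (simp add: prod.If_cases Int_def)
  then show ?thesis
    unfolding mix_prod_def * prod.distrib by simp
qed

text \<open>
  The weights in the following three lemmas are \<open>q\<close> to the number of edges that leave the deleted
  vertices towards larger vertices.
\<close>

lemma sum_board_prod_remove_row:
  fixes q u :: "'a::field"
  assumes "finite B" "q \<noteq> 0" "q \<noteq> 1" "u \<noteq> 0"
  shows "(\<Sum>b\<in>B. q ^ card {x \<in> B. b < x} * board_prod q A (B - {b}) \<mu> u) =
     (board_prod q A B \<mu> u - board_prod q A B \<mu> (u / q)) / (u * (1 - q))"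
  using sum_mix_prod_remove[of B q "\<lambda>_. True" u "\<lambda>b. inverse q ^ card {a \<in> A. a \<le> \<mu> b}"] assms
  unfolding board_prod_def by (simp add: eq_divide_eq mult_ac)

lemma sum_board_prod_remove_column:
  fixes q u :: "'a::field"
  assumes "finite A" "finite B" "q \<noteq> 0" "q \<noteq> 1" "mono_on B \<mu>"
  shows "(\<Sum>a\<in>A. q ^ (card {x \<in> A. a < x} + card {b \<in> B. \<not> a \<le> \<mu> b}) *
            board_prod q (A - {a}) B \<mu> u) =
     q ^ card B / (1 - q) * ((1 - u * q ^ card A) * board_prod q A B \<mu> u -
       q ^ card A * (1 - u * q ^ card B) * board_prod q A B \<mu> (u / q))"
proof -
  have cB: "card B = card {b \<in> B. \<not> a \<le> \<mu> b} + card {b \<in> B. a \<le> \<mu> b}" for a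
  proof -
    have "B = {b \<in> B. \<not> a \<le> \<mu> b} \<union> {b \<in> B. a \<le> \<mu> b}" by auto
    then show ?thesis
      using assms(2) by (subst card_Un_disjoint[symmetric]) auto
  qed
  have "(\<Sum>a\<in>A. q ^ (card {x \<in> A. a < x} + card {b \<in> B. \<not> a \<le> \<mu> b}) *
            board_prod q (A - {a}) B \<mu> u) =
        q ^ card B * (\<Sum>a\<in>A. q ^ card {x \<in> A. a < x} *
            mix_prod q B (\<lambda>b. inverse q ^ card {a \<in> A. a \<le> \<mu> b}) (\<lambda>b. if a \<le> \<mu> b then u / q else u))"
    unfolding board_prod_def sum_distrib_left
  proof (intro sum.cong refl)
    fix a assume "a \<in> A"
    then show "q ^ (card {x \<in> A. a < x} + card {b \<in> B. \<not> a \<le> \<mu> b}) *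
         mix_prod q B (\<lambda>b. inverse q ^ card {x \<in> A - {a}. x \<le> \<mu> b}) (\<lambda>_. u) =
         q ^ card B * (q ^ card {x \<in> A. a < x} *
          mix_prod q B (\<lambda>b. inverse q ^ card {a \<in> A. a \<le> \<mu> b}) (\<lambda>b. if a \<le> \<mu> b then u / q else u))"
      using assms by (subst mix_prod_remove_column) (auto simp: cB[of a] power_add mult_ac)
  qed
  also have "\<dots> = q ^ card B / (1 - q) * ((1 - q) * (\<Sum>a\<in>A. q ^ card {x \<in> A. a < x} *
            mix_prod q B (\<lambda>b. inverse q ^ card {a \<in> A. a \<le> \<mu> b}) (\<lambda>b. if a \<le> \<mu> b then u / q else u)))"
    using assms(4) by simp
  finally show ?thesis
    unfolding sum_mix_prod_column[OF assms] .
qed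

lemma sum_board_prod_remove_cell:
  fixes q u :: "'a::field"
  assumes "finite A" "finite B" "q \<noteq> 0" "q \<noteq> 1" "mono_on B \<mu>" "u \<noteq> 0"
  shows "(\<Sum>a\<in>A. \<Sum>b | b \<in> B \<and> a \<le> \<mu> b.
            q ^ (card {x \<in> A. a < x} + card {b \<in> B. \<not> a \<le> \<mu> b} + card {x \<in> B. b < x}) *
            board_prod q (A - {a}) (B - {b}) \<mu> u) =
     q ^ card B / (u * (1 - q)) * (qnum q (card A) * board_prod q A B \<mu> (u / q) -
       ((1 - u / q * q ^ card A) * board_prod q A B \<mu> (u / q) -
        q ^ card A * (1 - u / q * q ^ card B) * board_prod q A B \<mu> (u / q / q)) / (1 - q))"
proof -
  have cB: "card B = card {b \<in> B. \<not> a \<le> \<mu> b} + card {b \<in> B. a \<le> \<mu> b}" for a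
  proof -
    have "B = {b \<in> B. \<not> a \<le> \<mu> b} \<union> {b \<in> B. a \<le> \<mu> b}" by auto
    then show ?thesis
      using assms(2) by (subst card_Un_disjoint[symmetric]) auto
  qed
  define v where "v = (\<lambda>b. inverse q ^ card {a \<in> A. a \<le> \<mu> b})"
  define c where "c = (\<lambda>a. card {b \<in> B. a \<le> \<mu> b})"
  define T where "T = (\<lambda>a. mix_prod q B v (\<lambda>b. if a \<le> \<mu> b then u / q / q else u / q))"
  define P where "P = board_prod q A B \<mu> (u / q)"
  have inner: "(\<Sum>b | b \<in> B \<and> a \<le> \<mu> b. q ^ card {x \<in> B. b < x} *
            board_prod q (A - {a}) (B - {b}) \<mu> u) = q ^ c a * (P - T a) / (u * (1 - q))"
    if "a \<in> A" for a
  proof -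
    define v' where "v' = (\<lambda>b. inverse q ^ card {x \<in> A - {a}. x \<le> \<mu> b})"
    have "u * (1 - q) * (\<Sum>b | b \<in> B \<and> a \<le> \<mu> b. q ^ card {x \<in> B. b < x} *
              mix_prod q (B - {b}) v' (\<lambda>_. u)) =
          mix_prod q B v' (\<lambda>b. if a \<le> \<mu> b then u else u / q) - mix_prod q B v' (\<lambda>_. u / q)"
      using assms by (intro sum_mix_prod_remove) (auto simp: monotone_on_def intro: order.trans)
    also have "mix_prod q B v' (\<lambda>b. if a \<le> \<mu> b then u else u / q) = q ^ c a * P"
      unfolding v'_def mix_prod_remove_column[OF assms(1-3) that] c_def P_def board_prod_def
      by (intro arg_cong2[where f = "(*)"] refl mix_prod_cong) auto
    also have "mix_prod q B v' (\<lambda>_. u / q) = q ^ c a * T a"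
      unfolding v'_def mix_prod_remove_column[OF assms(1-3) that] c_def T_def v_def ..
    finally show ?thesis
      using assms unfolding board_prod_def v'_def[symmetric] by (simp add: field_simps)
  qed
  have "(\<Sum>a\<in>A. \<Sum>b | b \<in> B \<and> a \<le> \<mu> b.
            q ^ (card {x \<in> A. a < x} + card {b \<in> B. \<not> a \<le> \<mu> b} + card {x \<in> B. b < x}) *
            board_prod q (A - {a}) (B - {b}) \<mu> u) =
        (\<Sum>a\<in>A. q ^ (card {x \<in> A. a < x} + card {b \<in> B. \<not> a \<le> \<mu> b}) *
           (q ^ c a * (P - T a) / (u * (1 - q))))"
  proof (intro sum.cong refl, goal_cases)
    case (1 a)
    show ?case
      unfolding inner[OF 1, symmetric] by (simp add: sum_distrib_left power_add mult_ac)
  qed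
  also have "\<dots> = (\<Sum>a\<in>A. q ^ card B / (u * (1 - q)) *
                  (q ^ card {x \<in> A. a < x} * P - q ^ card {x \<in> A. a < x} * T a))"
  proof (intro sum.cong refl, goal_cases)
    case (1 a)
    show ?case
      unfolding cB[of a] c_def power_add by (simp add: algebra_simps diff_divide_distrib)
  qed
  also have "\<dots> = q ^ card B / (u * (1 - q)) * (qnum q (card A) * P -
                  (\<Sum>a\<in>A. q ^ card {x \<in> A. a < x} * T a))"
    by (simp only: sum_subtractf sum_power_card_greater[OF assms(1,4)]
          flip: sum_distrib_left sum_distrib_right)
  also have "(\<Sum>a\<in>A. q ^ card {x \<in> A. a < x} * T a) =
      ((1 - u / q * q ^ card A) * P -
        q ^ card A * (1 - u / q * q ^ card B) * board_prod q A B \<mu> (u / q / q)) / (1 - q)"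
    using sum_mix_prod_column[OF assms(1-5), of "u / q"] assms(4)
    unfolding P_def T_def v_def by (simp add: eq_divide_eq mult_ac)
  finally show ?thesis unfolding P_def .
qed

section \<open>Colourings and the least colour\<close>

text \<open>
  The proper colourings with positive colours of the graph that \<open>E\<close> induces on \<open>V\<close>, subject to the
  condition that the multiset of the colours used is \<open>M\<close>.
\<close>

definition colorings :: "(nat \<times> nat) set \<Rightarrow> nat set \<Rightarrow> nat multiset \<Rightarrow> (nat \<Rightarrow> nat) set" where
  "colorings E V M = {\<kappa> \<in> V \<rightarrow>\<^sub>E {1..}.
     (\<forall>(a, b)\<in>E. a \<in> V \<longrightarrow> b \<in> V \<longrightarrow> \<kappa> a \<noteq> \<kappa> b) \<and> image_mset \<kappa> (mset_set V) = M}"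

text \<open>
  The edges of the induced graph along which the colour increases; the first entry of an edge is
  meant to be its smaller vertex.
\<close>

definition ascents :: "(nat \<times> nat) set \<Rightarrow> nat set \<Rightarrow> (nat \<Rightarrow> nat) \<Rightarrow> (nat \<times> nat) set" where
  "ascents E V \<kappa> = {(a, b) \<in> E. a \<in> V \<and> b \<in> V \<and> \<kappa> a < \<kappa> b}"

text \<open>
  The coefficient of the monomial \<open>M\<close> in the chromatic quasisymmetric function of the graph that
  \<open>E\<close> induces on \<open>V\<close>.
\<close>

definition coloring_sum :: "'a::field \<Rightarrow> (nat \<times> nat) set \<Rightarrow> nat set \<Rightarrow> nat multiset \<Rightarrow> 'a" where
  "coloring_sum q E V M = (\<Sum>\<kappa>\<in>colorings E V M. q ^ card (ascents E V \<kappa>))"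

text \<open>
  No edge has both its vertices in \<open>S\<close>.
\<close>

definition independent_set :: "(nat \<times> nat) set \<Rightarrow> nat set \<Rightarrow> bool" where
  "independent_set E S \<longleftrightarrow> (\<forall>(a, b)\<in>E. \<not> (a \<in> S \<and> b \<in> S))"

lemma finite_colorings:
  assumes "finite V"
  shows "finite (colorings E V M)"
proof (rule finite_subset)
  show "colorings E V M \<subseteq> V \<rightarrow>\<^sub>E set_mset M"
    using assms by (auto simp: colorings_def PiE_iff extensional_def)
  show "finite (V \<rightarrow>\<^sub>E set_mset M)"
    using assms by (intro finite_PiE) auto
qed

text \<open>
  A proper colouring amounts to the independent set \<open>S\<close> of the vertices of least colour \<open>c\<close> together
  with a proper colouring of the remaining vertices by larger colours. An edge between \<open>S\<close> and its
  complement is an ascent if and only if its first vertex lies in \<open>S\<close>.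
\<close>

lemma coloring_sum_remove_least_color:
  assumes "finite V" "1 \<le> c" "\<And>d. d \<in># M \<Longrightarrow> c \<le> d"
  shows "coloring_sum q E V M =
    (\<Sum>S | S \<subseteq> V \<and> card S = count M c \<and> independent_set E S.
       q ^ card {(a, b) \<in> E. a \<in> S \<and> b \<in> V - S} *
       coloring_sum q E (V - S) (filter_mset (\<lambda>d. d \<noteq> c) M))"
proof -
  define M' where "M' = filter_mset (\<lambda>d. d \<noteq> c) M"
  define \<S> where "\<S> = {S. S \<subseteq> V \<and> card S = count M c \<and> independent_set E S}"
  define extend where "extend = (\<lambda>(S, \<kappa>) v. if (v :: nat) \<in> S then c else \<kappa> v)"
  define split where "split = (\<lambda>\<kappa>. ({v \<in> V. \<kappa> v = c}, restrict \<kappa> {v \<in> V. \<kappa> v \<noteq> c}))"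
  have fin: "finite S" if "S \<subseteq> V" for S using that assms(1) finite_subset by blast
  have large: "c < \<kappa> v" if "\<kappa> \<in> colorings E (V - S) M'" "v \<in> V - S" for \<kappa> S v
  proof -
    have "\<kappa> v \<in># image_mset \<kappa> (mset_set (V - S))" using that assms(1) by simp
    moreover have "image_mset \<kappa> (mset_set (V - S)) = M'" using that by (simp add: colorings_def)
    ultimately have "\<kappa> v \<in># M'" by (simp only:)
    then show ?thesis using assms(3) by (auto simp: M'_def le_neq_trans)
  qed
  have "coloring_sum q E V M =
      (\<Sum>(S, \<kappa>)\<in>(SIGMA S:\<S>. colorings E (V - S) M').
         q ^ card {(a, b) \<in> E. a \<in> S \<and> b \<in> V - S} * q ^ card (ascents E (V - S) \<kappa>))"
    unfolding coloring_sum_def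
  proof (rule sum.reindex_bij_witness[where i = extend and j = split], goal_cases)
    case (1 \<kappa>)
    then show ?case
      by (auto simp: extend_def split_def fun_eq_iff colorings_def PiE_iff extensional_def)
  next
    case (2 \<kappa>)
    define S where "S = {v \<in> V. \<kappa> v = c}"
    have S: "S \<subseteq> V" "{v \<in> V. \<kappa> v \<noteq> c} = V - S" by (auto simp: S_def)
    have "filter_mset (\<lambda>v. \<kappa> v = c) (mset_set V) = mset_set S"
      unfolding S_def using assms(1) by simp
    then have "card S = size (filter_mset (\<lambda>v. \<kappa> v = c) (mset_set V))"
      by simp
    also have "\<dots> = size (filter_mset (\<lambda>d. d = c) (image_mset \<kappa> (mset_set V)))"
      by (simp add: filter_mset_image_mset)
    also have "image_mset \<kappa> (mset_set V) = M" using 2 by (simp add: colorings_def)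
    finally have card: "card S = count M c"
      by (simp add: filter_eq_replicate_mset)
    have ind: "independent_set E S"
      using 2 by (force simp: independent_set_def colorings_def S_def)
    have "image_mset (restrict \<kappa> (V - S)) (mset_set (V - S)) = image_mset \<kappa> (mset_set (V - S))"
      using assms(1) by (intro image_mset_cong) auto
    also have "\<dots> = image_mset \<kappa> (filter_mset (\<lambda>v. \<kappa> v \<noteq> c) (mset_set V))"
      using assms(1) by (simp flip: S(2))
    also have "\<dots> = M'"
      using 2 by (auto simp: M'_def colorings_def filter_mset_image_mset)
    finally have image: "image_mset (restrict \<kappa> (V - S)) (mset_set (V - S)) = M'" .
    have "restrict \<kappa> (V - S) \<in> colorings E (V - S) M'"
      unfolding colorings_def by (intro CollectI conjI image) (use 2 in \<open>auto simp: colorings_def PiE_iff\<close>)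
    then show ?case
      using S card ind by (simp add: split_def \<S>_def flip: S_def)
  next
    case (3 p)
    then obtain S \<kappa> where p: "p = (S, \<kappa>)" "S \<in> \<S>" "\<kappa> \<in> colorings E (V - S) M'"
      by auto
    then have S: "S \<subseteq> V" by (simp add: \<S>_def)
    have ne: "\<kappa> v \<noteq> c" if "v \<in> V - S" for v using large[OF p(3) that] by simp
    have "{v \<in> V. extend p v = c} = S"
      using S ne by (auto simp: extend_def p)
    moreover have "restrict (extend p) (V - S) = \<kappa>"
      using p(3) by (auto simp: fun_eq_iff extend_def p colorings_def PiE_iff extensional_def)
    moreover from calculation(1) have "{v \<in> V. extend p v \<noteq> c} = V - S" by auto
    ultimately show ?case by (simp add: split_def p)
  next
    case (4 p)
    then obtain S \<kappa> where p: "p = (S, \<kappa>)" "S \<in> \<S>" "\<kappa> \<in> colorings E (V - S) M'"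
      by auto
    then have S: "S \<subseteq> V" "card S = count M c" "independent_set E S" by (auto simp: \<S>_def)
    have eS: "extend p v = c" if "v \<in> S" for v using that by (simp add: extend_def p)
    have eV: "extend p v = \<kappa> v" if "v \<in> V - S" for v using that by (simp add: extend_def p)
    have "mset_set V = mset_set S + mset_set (V - S)"
      using S assms(1) mset_set_Union[of S "V - S"] fin[OF S(1)] by (simp add: Un_absorb1)
    then have "image_mset (extend p) (mset_set V) =
         image_mset (extend p) (mset_set S) + image_mset (extend p) (mset_set (V - S))" by simp
    also have "image_mset (extend p) (mset_set S) = replicate_mset (count M c) c"
      using fin[OF S(1)] S(2) eS
      by (subst image_mset_cong[of _ _ "\<lambda>_. c"]) (auto simp: image_mset_const_eq)
    also have "image_mset (extend p) (mset_set (V - S)) = image_mset \<kappa> (mset_set (V - S))"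
      using assms(1) eV by (intro image_mset_cong) auto
    also have "\<dots> = M'" using p(3) by (simp add: colorings_def)
    also have "replicate_mset (count M c) c + M' = M"
      unfolding M'_def using multiset_partition[of M "\<lambda>d. d = c"] by (simp add: filter_eq_replicate_mset)
    finally have "image_mset (extend p) (mset_set V) = M" .
    moreover have "extend p a \<noteq> extend p b" if "(a, b) \<in> E" "a \<in> V" "b \<in> V" for a b
    proof -
      have "\<not> (a \<in> S \<and> b \<in> S)" using S(3) that by (auto simp: independent_set_def)
      moreover have "\<kappa> a \<noteq> \<kappa> b" if "a \<notin> S" "b \<notin> S"
        using p(3) that \<open>(a, b) \<in> E\<close> \<open>a \<in> V\<close> \<open>b \<in> V\<close> by (auto simp: colorings_def)
      ultimately show ?thesis
        using that large[OF p(3), of a] large[OF p(3), of b] by (auto simp: extend_def p)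
    qed
    moreover have "extend p \<in> V \<rightarrow>\<^sub>E {1..}"
      using p(3) S(1) assms(2) by (auto simp: extend_def p colorings_def PiE_iff extensional_def)
    ultimately show ?case by (auto simp: colorings_def)
  next
    case (5 \<kappa>)
    define S where "S = {v \<in> V. \<kappa> v = c}"
    have S: "S \<subseteq> V" "{v \<in> V. \<kappa> v \<noteq> c} = V - S" by (auto simp: S_def)
    have ge: "c \<le> \<kappa> v" if "v \<in> V" for v
    proof -
      have "\<kappa> v \<in># image_mset \<kappa> (mset_set V)" using that assms(1) by simp
      moreover have "image_mset \<kappa> (mset_set V) = M" using 5 by (simp add: colorings_def)
      ultimately show ?thesis using assms(3) by (simp only:)
    qed
    have "ascents E V \<kappa> = {(a, b) \<in> E. a \<in> S \<and> b \<in> V - S} \<union> ascents E (V - S) (restrict \<kappa> (V - S))"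
      using ge by (force simp: ascents_def S_def le_neq_implies_less)
    moreover have "finite {(a, b) \<in> E. a \<in> S \<and> b \<in> V - S}"
      by (rule finite_subset[of _ "V \<times> V"]) (use assms(1) in \<open>auto simp: S_def\<close>)
    moreover have "finite (ascents E (V - S) (restrict \<kappa> (V - S)))"
      by (rule finite_subset[of _ "V \<times> V"]) (use assms(1) in \<open>auto simp: ascents_def\<close>)
    ultimately have "card (ascents E V \<kappa>) = card {(a, b) \<in> E. a \<in> S \<and> b \<in> V - S} +
        card (ascents E (V - S) (restrict \<kappa> (V - S)))"
      by (simp only:) (rule card_Un_disjoint; auto simp: ascents_def)
    then show ?case
      by (simp add: split_def S power_add flip: S_def)
  qed
  also have "\<dots> = (\<Sum>S\<in>\<S>. \<Sum>\<kappa>\<in>colorings E (V - S) M'.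
         q ^ card {(a, b) \<in> E. a \<in> S \<and> b \<in> V - S} * q ^ card (ascents E (V - S) \<kappa>))"
    using assms(1) by (intro sum.Sigma[symmetric]) (auto simp: \<S>_def finite_colorings)
  finally show ?thesis
    unfolding coloring_sum_def sum_distrib_left \<S>_def M'_def .
qed

section \<open>Linear functionals on sequences\<close>

text \<open>
  A linear functional on sequences. The argument \<open>t\<close> of a sequence stands for the point
  \<open>u = 1 / q ^ t\<close>.
\<close>

definition linear_functional :: "((nat \<Rightarrow> 'a::field) \<Rightarrow> 'a) \<Rightarrow> bool" where
  "linear_functional L \<longleftrightarrow>
     (\<forall>f g. L (\<lambda>t. f t + g t) = L f + L g) \<and> (\<forall>c f. L (\<lambda>t. c * f t) = c * L f)"

lemma linear_functional_sum:
  assumes "linear_functional L"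
  shows "L (\<lambda>t. \<Sum>i\<in>I. c i * f i t) = (\<Sum>i\<in>I. c i * L (f i))"
proof -
  have add: "L (\<lambda>t. g t + h t) = L g + L h" and scale: "L (\<lambda>t. d * g t) = d * L g" for d g h
    using assms by (simp_all add: linear_functional_def)
  have zero: "L (\<lambda>t. 0) = 0"
    using scale[of 0 "\<lambda>_. 0"] by simp
  show ?thesis
  proof (induction I rule: infinite_finite_induct)
    case (insert i I)
    have "L (\<lambda>t. \<Sum>i\<in>insert i I. c i * f i t) = L (\<lambda>t. c i * f i t + (\<Sum>i\<in>I. c i * f i t))"
      using insert.hyps by simp
    also have "\<dots> = c i * L (f i) + (\<Sum>i\<in>I. c i * L (f i))"
      unfolding add[of "\<lambda>t. c i * f i t"] scale insert.IH ..
    finally show ?case using insert.hyps by simp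
  qed (simp_all add: zero)
qed

text \<open>
  Linear functionals remain linear after composition with a difference operator that has variable
  coefficients.
\<close>

lemma linear_functional_pullback:
  assumes "linear_functional L"
  shows "linear_functional (\<lambda>f. L (\<lambda>t. x t * f t + y t * f (t + k) + z t * f (t + l)))"
proof -
  have "L (\<lambda>t. x t * (f t + g t) + y t * (f (t + k) + g (t + k)) + z t * (f (t + l) + g (t + l))) =
       L (\<lambda>t. (x t * f t + y t * f (t + k) + z t * f (t + l)) +
               (x t * g t + y t * g (t + k) + z t * g (t + l)))" for f g
    by (intro arg_cong[of _ _ L] ext) (simp add: algebra_simps)
  moreover have "L (\<lambda>t. x t * (c * f t) + y t * (c * f (t + k)) + z t * (c * f (t + l))) =
       L (\<lambda>t. c * (x t * f t + y t * f (t + k) + z t * f (t + l)))" for c f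
    by (intro arg_cong[of _ _ L] ext) (simp add: algebra_simps)
  ultimately show ?thesis
    using assms by (simp add: linear_functional_def)
qed

lemma linear_functional_add:
  assumes "linear_functional K" "linear_functional L"
  shows "linear_functional (\<lambda>f. K f + L f)"
  using assms by (simp add: linear_functional_def algebra_simps)

section \<open>The graph of a board\<close>

text \<open>
  The graph of a board: the vertices up to \<open>m\<close> are columns, the others are rows, the columns form
  a clique, the rows form a clique, and column \<open>a\<close> is joined to row \<open>b\<close> unless \<open>a \<le> \<mu> b\<close>, that
  is, unless they meet in a cell of the board.
\<close>

definition two_cliques :: "nat \<Rightarrow> (nat \<Rightarrow> nat) \<Rightarrow> (nat \<times> nat) set" where
  "two_cliques m \<mu> = {(a, b). a < b \<and> \<not> (a \<le> m \<and> m < b \<and> a \<le> \<mu> b)}"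

lemma independent_set_two_cliques:
  assumes "S \<subseteq> A \<union> B" "A \<subseteq> {..m}" "B \<subseteq> {m<..}"
  shows "independent_set (two_cliques m \<mu>) S \<longleftrightarrow> S = {} \<or> (\<exists>v\<in>A \<union> B. S = {v}) \<or>
           (\<exists>a\<in>A. \<exists>b\<in>B. a \<le> \<mu> b \<and> S = {a, b})"
proof
  assume ind: "independent_set (two_cliques m \<mu>) S"
  have edge: "a \<le> m \<and> m < b \<and> a \<le> \<mu> b" if "a \<in> S" "b \<in> S" "a < b" for a b
    using ind that by (auto simp: independent_set_def two_cliques_def)
  show "S = {} \<or> (\<exists>v\<in>A \<union> B. S = {v}) \<or> (\<exists>a\<in>A. \<exists>b\<in>B. a \<le> \<mu> b \<and> S = {a, b})"
  proof (cases "\<exists>a\<in>S. \<exists>b\<in>S. a < b")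
    case True
    then obtain a b where ab: "a \<in> S" "b \<in> S" "a < b" by auto
    have "x = a \<or> x = b" if "x \<in> S" for x
      using edge[OF ab] edge[of x a] edge[of a x] edge[of x b] edge[of b x] that ab
      by (meson not_le linorder_neqE_nat)
    then have "S = {a, b}" using ab by auto
    moreover have "a \<in> A" "b \<in> B"
      using edge[OF ab] ab assms by (auto simp: subset_iff)
    ultimately show ?thesis using edge[OF ab] by auto
  next
    case False
    then have eq: "x = y" if "x \<in> S" "y \<in> S" for x y
      using that by (meson linorder_neqE_nat)
    show ?thesis
    proof (cases "S = {}")
      case False
      then obtain x where x: "x \<in> S" by blast
      with eq have "S = {x}" by blast
      then show ?thesis using x assms(1) by blast
    qed simp
  qed
next
  have lt: "\<not> b < a" if "a \<in> A" "b \<in> B" for a b using that assms(2,3) by fastforce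
  assume "S = {} \<or> (\<exists>v\<in>A \<union> B. S = {v}) \<or> (\<exists>a\<in>A. \<exists>b\<in>B. a \<le> \<mu> b \<and> S = {a, b})"
  then show "independent_set (two_cliques m \<mu>) S"
    using assms by (auto simp: independent_set_def two_cliques_def subset_iff dest: lt)
qed

lemma card_edges_from_column:
  assumes "finite A" "finite B" "A \<subseteq> {..m}" "B \<subseteq> {m<..}" "a \<in> A"
  shows "card {(x, y) \<in> two_cliques m \<mu>. x \<in> {a} \<and> y \<in> (A \<union> B) - {a}} =
     card {x \<in> A. a < x} + card {b \<in> B. \<not> a \<le> \<mu> b}"
proof -
  have "{(x, y) \<in> two_cliques m \<mu>. x \<in> {a} \<and> y \<in> (A \<union> B) - {a}} =
      Pair a ` ({x \<in> A. a < x} \<union> {b \<in> B. \<not> a \<le> \<mu> b})"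
    using assms by (fastforce simp: two_cliques_def)
  moreover have "card \<dots> = card ({x \<in> A. a < x} \<union> {b \<in> B. \<not> a \<le> \<mu> b})"
    by (intro card_image) (auto simp: inj_on_def)
  moreover have "\<dots> = card {x \<in> A. a < x} + card {b \<in> B. \<not> a \<le> \<mu> b}"
    using assms by (intro card_Un_disjoint) fastforce+
  ultimately show ?thesis by simp
qed

lemma card_edges_from_row:
  assumes "finite A" "finite B" "A \<subseteq> {..m}" "B \<subseteq> {m<..}" "b \<in> B"
  shows "card {(x, y) \<in> two_cliques m \<mu>. x \<in> {b} \<and> y \<in> (A \<union> B) - {b}} =
     card {x \<in> B. b < x}"
proof -
  have "{(x, y) \<in> two_cliques m \<mu>. x \<in> {b} \<and> y \<in> (A \<union> B) - {b}} =
      Pair b ` {x \<in> B. b < x}"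
    using assms by (fastforce simp: two_cliques_def)
  moreover have "card \<dots> = card {x \<in> B. b < x}"
    by (intro card_image) (auto simp: inj_on_def)
  ultimately show ?thesis by simp
qed

lemma card_edges_from_cell:
  assumes "finite A" "finite B" "A \<subseteq> {..m}" "B \<subseteq> {m<..}" "a \<in> A" "b \<in> B" "a \<le> \<mu> b"
  shows "card {(x, y) \<in> two_cliques m \<mu>. x \<in> {a, b} \<and> y \<in> (A \<union> B) - {a, b}} =
     card {x \<in> A. a < x} + card {b \<in> B. \<not> a \<le> \<mu> b} + card {x \<in> B. b < x}"
proof -
  define X where "X = {(x, y) \<in> two_cliques m \<mu>. x \<in> {a} \<and> y \<in> (A \<union> B) - {a}}"
  define Y where "Y = {(x, y) \<in> two_cliques m \<mu>. x \<in> {b} \<and> y \<in> (A \<union> B) - {b}}"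
  have "{(x, y) \<in> two_cliques m \<mu>. x \<in> {a, b} \<and> y \<in> (A \<union> B) - {a, b}} = X \<union> Y"
    using assms by (fastforce simp: two_cliques_def X_def Y_def)
  moreover have "X \<inter> Y = {}"
    using assms by (fastforce simp: X_def Y_def)
  moreover have "finite X" "finite Y"
    by (rule finite_subset[of _ "(A \<union> B) \<times> (A \<union> B)"]; use assms in \<open>auto simp: X_def Y_def\<close>)+
  ultimately show ?thesis
    using card_edges_from_column[OF assms(1-5)] card_edges_from_row[OF assms(1-4,6)]
    by (simp add: card_Un_disjoint X_def Y_def)
qed

lemma coloring_sum_two_cliques:
  fixes q :: "'a::field" and \<mu> :: "nat \<Rightarrow> nat"
  assumes "finite A" "finite B" "A \<subseteq> {..m}" "B \<subseteq> {m<..}"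
    "1 \<le> c" "c \<in># M" "\<forall>d\<in>#M. c \<le> d"
  defines "M' \<equiv> filter_mset (\<lambda>d. d \<noteq> c) M" and "E \<equiv> two_cliques m \<mu>"
  shows "coloring_sum q E (A \<union> B) M =
    (if count M c = 1 then
       (\<Sum>a\<in>A. q ^ (card {x \<in> A. a < x} + card {b \<in> B. \<not> a \<le> \<mu> b}) *
          coloring_sum q E ((A - {a}) \<union> B) M') +
       (\<Sum>b\<in>B. q ^ card {x \<in> B. b < x} * coloring_sum q E (A \<union> (B - {b})) M')
     else if count M c = 2 then
       (\<Sum>a\<in>A. \<Sum>b | b \<in> B \<and> a \<le> \<mu> b.
          q ^ (card {x \<in> A. a < x} + card {b \<in> B. \<not> a \<le> \<mu> b} + card {x \<in> B. b < x}) *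
          coloring_sum q E ((A - {a}) \<union> (B - {b})) M')
     else 0)"
proof -
  define V where "V = A \<union> B"
  define F where "F = (\<lambda>S. q ^ card {(x, y) \<in> E. x \<in> S \<and> y \<in> V - S} * coloring_sum q E (V - S) M')"
  define I where "I = {S. S \<subseteq> V \<and> card S = count M c \<and> independent_set E S}"
  have disj: "A \<inter> B = {}" and fV: "finite V" using assms by (fastforce simp: V_def)+
  have eq: "coloring_sum q E (A \<union> B) M = sum F I"
    using coloring_sum_remove_least_color[OF fV assms(5), of M q E] assms(7)
    unfolding F_def I_def V_def M'_def by blast
  have pos: "count M c > 0" using assms(6) by simp
  have I: "S \<in> I \<longleftrightarrow> card S = count M c \<and> ((\<exists>v\<in>A \<union> B. S = {v}) \<or>
           (\<exists>a\<in>A. \<exists>b\<in>B. a \<le> \<mu> b \<and> S = {a, b}))" for S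
  proof (cases "S \<subseteq> V")
    case True
    then have "independent_set E S \<longleftrightarrow> S = {} \<or> (\<exists>v\<in>A \<union> B. S = {v}) \<or>
           (\<exists>a\<in>A. \<exists>b\<in>B. a \<le> \<mu> b \<and> S = {a, b})"
      using True independent_set_two_cliques[of S A B m \<mu>] assms(3,4) by (simp add: V_def E_def)
    moreover have "\<not> (S = {} \<and> card S = count M c)" using pos by auto
    ultimately show ?thesis
      using True unfolding I_def by blast
  next
    case False
    then show ?thesis by (auto simp: I_def V_def)
  qed
  have card2: "card {a, b} = 2" if "a \<in> A" "b \<in> B" for a b
    using that disj by (auto simp: card_insert_if)
  \<comment> \<open>The multiplicity of the least colour decides which of the independent sets occur.\<close>
  consider "count M c = 1" | "count M c = 2" | "count M c > 2" using pos by linarith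
  then show ?thesis
  proof cases
    case 1
    have "I = (\<lambda>v. {v}) ` (A \<union> B)"
      using card2 by (force simp: I 1)
    then have "sum F I = (\<Sum>v\<in>A \<union> B. F {v})"
      by (simp add: sum.reindex)
    also have "\<dots> = (\<Sum>a\<in>A. F {a}) + (\<Sum>b\<in>B. F {b})"
      using assms(1,2) disj by (rule sum.union_disjoint)
    also have "(\<Sum>a\<in>A. F {a}) = (\<Sum>a\<in>A. q ^ (card {x \<in> A. a < x} + card {b \<in> B. \<not> a \<le> \<mu> b}) *
          coloring_sum q E ((A - {a}) \<union> B) M')"
    proof (intro sum.cong refl)
      fix a assume a: "a \<in> A"
      then have "A \<union> B - {a} = (A - {a}) \<union> B" using disj by auto
      then show "F {a} = q ^ (card {x \<in> A. a < x} + card {b \<in> B. \<not> a \<le> \<mu> b}) *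
          coloring_sum q E ((A - {a}) \<union> B) M'"
        unfolding F_def E_def V_def card_edges_from_column[OF assms(1-4) a] by simp
    qed
    also have "(\<Sum>b\<in>B. F {b}) = (\<Sum>b\<in>B. q ^ card {x \<in> B. b < x} * coloring_sum q E (A \<union> (B - {b})) M')"
    proof (intro sum.cong refl)
      fix b assume b: "b \<in> B"
      then have "A \<union> B - {b} = A \<union> (B - {b})" using disj by auto
      then show "F {b} = q ^ card {x \<in> B. b < x} * coloring_sum q E (A \<union> (B - {b})) M'"
        unfolding F_def E_def V_def card_edges_from_row[OF assms(1-4) b] by simp
    qed
    finally show ?thesis using eq 1 by simp
  next
    case 2
    define C where "C = (SIGMA a:A. {b \<in> B. a \<le> \<mu> b})"
    have "I = (\<lambda>(a, b). {a, b}) ` C"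
      using card2 by (force simp: I 2 C_def)
    moreover have "inj_on (\<lambda>(a, b). {a, b}) C"
      using disj by (auto simp: inj_on_def C_def doubleton_eq_iff)
    ultimately have "sum F I = (\<Sum>(a, b)\<in>C. F {a, b})"
      by (simp add: sum.reindex case_prod_unfold)
    also have "\<dots> = (\<Sum>a\<in>A. \<Sum>b | b \<in> B \<and> a \<le> \<mu> b. F {a, b})"
      unfolding C_def using assms(1,2) by (intro sum.Sigma[symmetric]) auto
    also have "\<dots> = (\<Sum>a\<in>A. \<Sum>b | b \<in> B \<and> a \<le> \<mu> b.
          q ^ (card {x \<in> A. a < x} + card {b \<in> B. \<not> a \<le> \<mu> b} + card {x \<in> B. b < x}) *
          coloring_sum q E ((A - {a}) \<union> (B - {b})) M')"
    proof (intro sum.cong refl)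
      fix a b assume a: "a \<in> A" and b: "b \<in> {b \<in> B. a \<le> \<mu> b}"
      then have "A \<union> B - {a, b} = (A - {a}) \<union> (B - {b})" using disj by auto
      then show "F {a, b} = q ^ (card {x \<in> A. a < x} + card {b \<in> B. \<not> a \<le> \<mu> b} + card {x \<in> B. b < x}) *
          coloring_sum q E ((A - {a}) \<union> (B - {b})) M'"
        unfolding F_def E_def V_def using card_edges_from_cell[OF assms(1-4) a, of b \<mu>] b by simp
    qed
    finally show ?thesis using eq 2 by simp
  next
    case 3
    then have "I = {}" using card2 by (force simp: I)
    then show ?thesis using eq 3 by simp
  qed
qed

lemma coloring_sum_empty: "coloring_sum q E {} {#} = 1"
proof -
  have "colorings E {} {#} = {\<lambda>_. undefined}" by (auto simp: colorings_def)
  then show ?thesis by (simp add: coloring_sum_def ascents_def)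
qed

lemma coloring_sum_eq_0:
  assumes "finite V" "0 \<in># M \<or> (M = {#} \<and> V \<noteq> {})"
  shows "coloring_sum q E V M = 0"
proof -
  have "\<kappa> \<notin> colorings E V M" for \<kappa>
  proof
    assume \<kappa>: "\<kappa> \<in> colorings E V M"
    then have "image_mset \<kappa> (mset_set V) = M" by (simp add: colorings_def)
    then have "set_mset M = \<kappa> ` V" "M = {#} \<longrightarrow> V = {}"
      using assms(1) by (auto simp: mset_set_empty_iff)
    moreover have "0 \<notin> \<kappa> ` V"
      using \<kappa> by (fastforce simp: colorings_def PiE_iff)
    ultimately show False using assms(2) by auto
  qed
  then have "colorings E V M = {}" by auto
  then show ?thesis by (simp add: coloring_sum_def)
qed

text \<open>
  The functional \<open>L\<close> is uniform in the board: it may depend on \<open>m\<close>, on the numbers \<open>r\<close> of columns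
  and \<open>s\<close> of rows and on the monomial \<open>M\<close>, but not on \<open>A\<close>, \<open>B\<close> and \<open>\<mu>\<close>. The induction deletes the
  vertices of least colour.
\<close>

lemma coloring_sum_linear_in_board_prod:
  fixes q :: "'a::field"
  assumes q: "q \<noteq> 0" "q \<noteq> 1"
  shows "\<exists>L. linear_functional L \<and> (\<forall>A B \<mu>. finite A \<longrightarrow> finite B \<longrightarrow> A \<subseteq> {..m} \<longrightarrow> B \<subseteq> {m<..} \<longrightarrow>
      card A = r \<longrightarrow> card B = s \<longrightarrow> mono_on B \<mu> \<longrightarrow>
      coloring_sum q (two_cliques m \<mu>) (A \<union> B) M = L (\<lambda>t. board_prod q A B \<mu> (1 / q ^ t)))"
proof (induction M arbitrary: r s rule: measure_induct_rule[of size])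
  case (less M)
  have u_div: "1 / q ^ t / q = 1 / q ^ (t + 1)" "1 / q ^ t / q / q = 1 / q ^ (t + 2)" for t
    by (simp_all add: power_add power2_eq_square)
  have ring1: "k * (x * f - y * z * g) = k * x * f + - (k * (y * z)) * g + 0 * h"
    and ring2: "(f - g) / x = 1 / x * f + - (1 / x) * g + 0 * h"
    and ring3: "k * (x * f - (y * f - z * g) / w) = k * (x - y / w) * f + k * (z / w) * g"
    for k x y z w f g h :: 'a
    by (simp_all add: algebra_simps diff_divide_distrib)
  have lin0: "linear_functional (\<lambda>_. 0 :: 'a)" by (simp add: linear_functional_def)
  show ?case
  proof (cases "M = {#} \<or> 0 \<in># M")
    case True
    show ?thesis
    proof (cases "M = {#} \<and> r = 0 \<and> s = 0")
      case True
      have "linear_functional (\<lambda>f. f 0 :: 'a)" by (simp add: linear_functional_def)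
      then show ?thesis
        using True by (intro exI[of _ "\<lambda>f. f 0"])
          (auto simp: coloring_sum_empty board_prod_def mix_prod_def)
    next
      case False
      show ?thesis
      proof (intro exI[of _ "\<lambda>_. 0"] conjI lin0 allI impI coloring_sum_eq_0)
        fix A B :: "nat set"
        assume AB: "finite A" "finite B" "card A = r" "card B = s"
        show "finite (A \<union> B)" using AB by simp
        show "0 \<in># M \<or> M = {#} \<and> A \<union> B \<noteq> {}"
          using False True AB by (metis Un_empty card.empty)
      qed
    qed
  next
    case False
    define c where "c = Min_mset M"
    have c: "c \<in># M" "\<forall>d\<in>#M. c \<le> d"
      using False by (auto simp: c_def)
    then have c1: "1 \<le> c" using False by (cases c) auto
    define M' where "M' = filter_mset (\<lambda>d. d \<noteq> c) M"
    have "M' \<subseteq># M" by (simp add: M'_def)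
    moreover have "c \<notin># M'" by (simp add: M'_def)
    then have "M' \<noteq> M" using c(1) by metis
    ultimately have "M' \<subset># M" by (rule subset_mset.le_neq_trans)
    then have "size M' < size M" by (rule mset_subset_size)
    note IH = less.IH[OF this]
    note step = coloring_sum_two_cliques[OF _ _ _ _ c1 c, folded M'_def]
    have "count M c > 0" using c(1) by simp
    then consider "count M c = 1" | "count M c = 2" | "count M c > 2" by linarith
    then show ?thesis
    proof cases
      case 1
      obtain L1 where L1: "linear_functional L1" "\<And>A B \<mu>. finite A \<Longrightarrow> finite B \<Longrightarrow> A \<subseteq> {..m} \<Longrightarrow>
          B \<subseteq> {m<..} \<Longrightarrow> card A = r - 1 \<Longrightarrow> card B = s \<Longrightarrow> mono_on B \<mu> \<Longrightarrow>
        coloring_sum q (two_cliques m \<mu>) (A \<union> B) M' = L1 (\<lambda>t. board_prod q A B \<mu> (1 / q ^ t))"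
        using IH[of "r - 1" s] by blast
      obtain L2 where L2: "linear_functional L2" "\<And>A B \<mu>. finite A \<Longrightarrow> finite B \<Longrightarrow> A \<subseteq> {..m} \<Longrightarrow>
          B \<subseteq> {m<..} \<Longrightarrow> card A = r \<Longrightarrow> card B = s - 1 \<Longrightarrow> mono_on B \<mu> \<Longrightarrow>
        coloring_sum q (two_cliques m \<mu>) (A \<union> B) M' = L2 (\<lambda>t. board_prod q A B \<mu> (1 / q ^ t))"
        using IH[of r "s - 1"] by blast
      \<comment> \<open>The coefficients of the values at u and u / q in the sums over the deleted column and
         over the deleted row; replacing u by u / q means replacing t by t + 1.\<close>
      define x1 where "x1 = (\<lambda>t. q ^ s / (1 - q) * (1 - 1 / q ^ t * q ^ r))"
      define y1 where "y1 = (\<lambda>t. - (q ^ s / (1 - q) * (q ^ r * (1 - 1 / q ^ t * q ^ s))))"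
      define x2 where "x2 = (\<lambda>t. 1 / (1 / q ^ t * (1 - q)))"
      define L where "L = (\<lambda>f. L1 (\<lambda>t. x1 t * f t + y1 t * f (t + 1) + 0 * f (t + 2)) +
                               L2 (\<lambda>t. x2 t * f t + (- x2 t) * f (t + 1) + 0 * f (t + 2)))"
      have "linear_functional L"
        unfolding L_def by (intro linear_functional_add linear_functional_pullback L1 L2)
      moreover have "coloring_sum q (two_cliques m \<mu>) (A \<union> B) M = L (\<lambda>t. board_prod q A B \<mu> (1 / q ^ t))"
        if AB: "finite A" "finite B" "A \<subseteq> {..m}" "B \<subseteq> {m<..}" "card A = r" "card B = s" "mono_on B \<mu>"
        for A B \<mu>
      proof -
        have "(\<Sum>a\<in>A. q ^ (card {x \<in> A. a < x} + card {b \<in> B. \<not> a \<le> \<mu> b}) *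
            coloring_sum q (two_cliques m \<mu>) ((A - {a}) \<union> B) M') =
          (\<Sum>a\<in>A. q ^ (card {x \<in> A. a < x} + card {b \<in> B. \<not> a \<le> \<mu> b}) *
            L1 (\<lambda>t. board_prod q (A - {a}) B \<mu> (1 / q ^ t)))"
          using AB by (intro sum.cong refl arg_cong2[where f = "(*)"] L1(2)) auto
        also have "\<dots> = L1 (\<lambda>t. x1 t * board_prod q A B \<mu> (1 / q ^ t) +
            y1 t * board_prod q A B \<mu> (1 / q ^ (t + 1)) + 0 * board_prod q A B \<mu> (1 / q ^ (t + 2)))"
          unfolding linear_functional_sum[OF L1(1), symmetric]
            sum_board_prod_remove_column[OF AB(1,2) q AB(7)] AB(5,6) u_div
            x1_def y1_def
          by (intro arg_cong[of _ _ L1] ext ring1)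
        finally have col: "(\<Sum>a\<in>A. q ^ (card {x \<in> A. a < x} + card {b \<in> B. \<not> a \<le> \<mu> b}) *
            coloring_sum q (two_cliques m \<mu>) ((A - {a}) \<union> B) M') = \<dots>" .
        have mono: "mono_on (B - {b}) \<mu>" for b
          using AB(7) by (auto simp: monotone_on_def)
        have "(\<Sum>b\<in>B. q ^ card {x \<in> B. b < x} *
            coloring_sum q (two_cliques m \<mu>) (A \<union> (B - {b})) M') =
          (\<Sum>b\<in>B. q ^ card {x \<in> B. b < x} * L2 (\<lambda>t. board_prod q A (B - {b}) \<mu> (1 / q ^ t)))"
          using AB mono by (intro sum.cong refl arg_cong2[where f = "(*)"] L2(2)) auto
        also have "\<dots> = L2 (\<lambda>t. x2 t * board_prod q A B \<mu> (1 / q ^ t) +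
            (- x2 t) * board_prod q A B \<mu> (1 / q ^ (t + 1)) + 0 * board_prod q A B \<mu> (1 / q ^ (t + 2)))"
          unfolding linear_functional_sum[OF L2(1), symmetric]
        proof (intro arg_cong[of _ _ L2] ext)
          fix t
          show "(\<Sum>b\<in>B. q ^ card {x \<in> B. b < x} * board_prod q A (B - {b}) \<mu> (1 / q ^ t)) =
            x2 t * board_prod q A B \<mu> (1 / q ^ t) +
            (- x2 t) * board_prod q A B \<mu> (1 / q ^ (t + 1)) + 0 * board_prod q A B \<mu> (1 / q ^ (t + 2))"
            unfolding x2_def using q
            by (subst sum_board_prod_remove_row[OF AB(2) q]) (simp, simp only: u_div ring2)
        qed
        finally have row: "(\<Sum>b\<in>B. q ^ card {x \<in> B. b < x} *
            coloring_sum q (two_cliques m \<mu>) (A \<union> (B - {b})) M') = \<dots>" .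
        show ?thesis
          using step[OF AB(1-4), where q = q and \<mu> = \<mu>] unfolding L_def row col if_P[OF 1] .
      qed
      ultimately show ?thesis by (intro exI[of _ L] conjI allI impI)
    next
      case 2
      obtain L1 where L1: "linear_functional L1" "\<And>A B \<mu>. finite A \<Longrightarrow> finite B \<Longrightarrow> A \<subseteq> {..m} \<Longrightarrow>
          B \<subseteq> {m<..} \<Longrightarrow> card A = r - 1 \<Longrightarrow> card B = s - 1 \<Longrightarrow> mono_on B \<mu> \<Longrightarrow>
        coloring_sum q (two_cliques m \<mu>) (A \<union> B) M' = L1 (\<lambda>t. board_prod q A B \<mu> (1 / q ^ t))"
        using IH[of "r - 1" "s - 1"] by blast
      \<comment> \<open>The coefficients of the values at u / q and u / q / q in the sum over the deleted cell.\<close>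
      define k where "k = (\<lambda>t. q ^ s / (1 / q ^ t * (1 - q)))"
      define y where "y = (\<lambda>t. k t * (qnum q r - (1 - 1 / q ^ (t + 1) * q ^ r) / (1 - q)))"
      define z where "z = (\<lambda>t. k t * (q ^ r * (1 - 1 / q ^ (t + 1) * q ^ s) / (1 - q)))"
      define L where "L = (\<lambda>f. L1 (\<lambda>t. 0 * f t + y t * f (t + 1) + z t * f (t + 2)))"
      have "linear_functional L"
        unfolding L_def by (intro linear_functional_pullback L1)
      moreover have "coloring_sum q (two_cliques m \<mu>) (A \<union> B) M = L (\<lambda>t. board_prod q A B \<mu> (1 / q ^ t))"
        if AB: "finite A" "finite B" "A \<subseteq> {..m}" "B \<subseteq> {m<..}" "card A = r" "card B = s" "mono_on B \<mu>"
        for A B \<mu>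
      proof -
        define w where "w = (\<lambda>(a, b). q ^ (card {x \<in> A. a < x} + card {b \<in> B. \<not> a \<le> \<mu> b} + card {x \<in> B. b < x}))"
        have mono: "mono_on (B - {b}) \<mu>" for b
          using AB(7) by (auto simp: monotone_on_def)
        define C where "C = (SIGMA a:A. {b \<in> B. a \<le> \<mu> b})"
        have sig: "(\<Sum>a\<in>A. \<Sum>b | b \<in> B \<and> a \<le> \<mu> b. g a b) = (\<Sum>p\<in>C. g (fst p) (snd p))" for g :: "nat \<Rightarrow> nat \<Rightarrow> 'a"
          unfolding C_def using AB(1,2) by (subst sum.Sigma) (auto simp: case_prod_unfold)
        have "(\<Sum>a\<in>A. \<Sum>b | b \<in> B \<and> a \<le> \<mu> b. w (a, b) *
              coloring_sum q (two_cliques m \<mu>) ((A - {a}) \<union> (B - {b})) M') =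
          (\<Sum>a\<in>A. \<Sum>b | b \<in> B \<and> a \<le> \<mu> b. w (a, b) *
            L1 (\<lambda>t. board_prod q (A - {a}) (B - {b}) \<mu> (1 / q ^ t)))"
          using AB mono by (intro sum.cong refl arg_cong2[where f = "(*)"] L1(2)) auto
        also have "\<dots> = L1 (\<lambda>t. \<Sum>a\<in>A. \<Sum>b | b \<in> B \<and> a \<le> \<mu> b. w (a, b) *
            board_prod q (A - {a}) (B - {b}) \<mu> (1 / q ^ t))"
          by (simp only: sig linear_functional_sum[OF L1(1)])
        also have "\<dots> = L1 (\<lambda>t. 0 * board_prod q A B \<mu> (1 / q ^ t) +
            y t * board_prod q A B \<mu> (1 / q ^ (t + 1)) + z t * board_prod q A B \<mu> (1 / q ^ (t + 2)))"
        proof (intro arg_cong[of _ _ L1] ext)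
          fix t
          define X where "X = board_prod q A B \<mu> (1 / q ^ (t + 1))"
          define Y where "Y = board_prod q A B \<mu> (1 / q ^ (t + 2))"
          have "(\<Sum>a\<in>A. \<Sum>b | b \<in> B \<and> a \<le> \<mu> b. w (a, b) *
              board_prod q (A - {a}) (B - {b}) \<mu> (1 / q ^ t)) =
              k t * (qnum q r * X - ((1 - 1 / q ^ (t + 1) * q ^ r) * X -
                q ^ r * (1 - 1 / q ^ (t + 1) * q ^ s) * Y) / (1 - q))"
            unfolding w_def prod.case using sum_board_prod_remove_cell[OF AB(1,2) q AB(7), of "1 / q ^ t"] q
            unfolding X_def Y_def k_def u_div AB(5,6) by simp
          also have "\<dots> = y t * X + z t * Y"
            unfolding y_def z_def by (rule ring3)
          finally show "(\<Sum>a\<in>A. \<Sum>b | b \<in> B \<and> a \<le> \<mu> b. w (a, b) *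
              board_prod q (A - {a}) (B - {b}) \<mu> (1 / q ^ t)) =
             0 * board_prod q A B \<mu> (1 / q ^ t) +
            y t * board_prod q A B \<mu> (1 / q ^ (t + 1)) + z t * board_prod q A B \<mu> (1 / q ^ (t + 2))"
            by (simp add: X_def Y_def)
        qed
        finally have cell: "(\<Sum>a\<in>A. \<Sum>b | b \<in> B \<and> a \<le> \<mu> b. w (a, b) *
              coloring_sum q (two_cliques m \<mu>) ((A - {a}) \<union> (B - {b})) M') = \<dots>" .
        have "count M c \<noteq> 1" using 2 by simp
        then show ?thesis
          using step[OF AB(1-4), where q = q and \<mu> = \<mu>] unfolding L_def cell[symmetric] w_def
          by (simp only: if_False if_P[OF 2] prod.case)
      qed
      ultimately show ?thesis by (intro exI[of _ L] conjI allI impI)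
    next
      case 3
      then have ne: "count M c \<noteq> 1" "count M c \<noteq> 2" by auto
      show ?thesis
      proof (intro exI[of _ "\<lambda>_. 0"] conjI lin0 allI impI)
        fix A B :: "nat set" and \<mu> :: "nat \<Rightarrow> nat"
        assume "finite A" "finite B" "A \<subseteq> {..m}" "B \<subseteq> {m<..}"
        from step[OF this, where q = q and \<mu> = \<mu>]
        show "coloring_sum q (two_cliques m \<mu>) (A \<union> B) M = 0"
          unfolding if_not_P[OF ne(1)] if_not_P[OF ne(2)] .
      qed
    qed
  qed
qed

section \<open>Rook placements and the factorization theorem\<close>

text \<open>
  No two rooks share a row or a column.
\<close>

definition nonattacking :: "(nat \<times> nat) set \<Rightarrow> bool" where
  "nonattacking p \<longleftrightarrow> (\<forall>(i, j)\<in>p. \<forall>(i', j')\<in>p. (i, j) \<noteq> (i', j') \<longrightarrow> i \<noteq> i' \<and> j \<noteq> j')"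

text \<open>
  The placements of \<open>k\<close> non-attacking rooks on an arbitrary set \<open>C\<close> of cells.
\<close>

definition placements :: "(nat \<times> nat) set \<Rightarrow> nat \<Rightarrow> (nat \<times> nat) set set" where
  "placements C k = {p. p \<subseteq> C \<and> card p = k \<and> nonattacking p}"

text \<open>
  The cells of \<open>C\<close> that are left after each rook has cancelled its own cell, the cells above it in
  its column and the cells to the left of it in its row.
\<close>

definition uncancelled :: "(nat \<times> nat) set \<Rightarrow> (nat \<times> nat) set \<Rightarrow> (nat \<times> nat) set" where
  "uncancelled C p = {(i, j) \<in> C. \<not> (\<exists>(r, s)\<in>p. (j = s \<and> i \<le> r) \<or> (i = r \<and> j \<le> s))}"

text \<open>
  The q-rook numbers of an arbitrary set of cells.
\<close>

definition rook_sum :: "'a::field \<Rightarrow> (nat \<times> nat) set \<Rightarrow> nat \<Rightarrow> 'a" where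
  "rook_sum q C k = (\<Sum>p\<in>placements C k. q ^ card (uncancelled C p))"

text \<open>
  The cells in the rows \<open>i \<in> I\<close>, row \<open>i\<close> being left-justified of length \<open>lam i\<close>.
\<close>

abbreviation row_cells :: "nat set \<Rightarrow> (nat \<Rightarrow> nat) \<Rightarrow> (nat \<times> nat) set" where
  "row_cells I lam \<equiv> (SIGMA i:I. {1..lam i})"

lemma qrook_eq_rook_sum: "qrook q n lam k = rook_sum q (cells n lam) k"
  by (simp add: qrook_def rook_sum_def rook_placements_def placements_def nonattacking_def
        rook_inv_def uncancelled_def)

lemma cells_eq_row_cells: "cells n lam = row_cells {1..n} lam"
  by (auto simp: cells_def)

lemma finite_placements:
  assumes "finite C"
  shows "finite (placements C k)"
  by (rule finite_subset[of _ "Pow C"]) (use assms in \<open>auto simp: placements_def\<close>)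

lemma nonattacking_subset: "nonattacking p \<Longrightarrow> p' \<subseteq> p \<Longrightarrow> nonattacking p'"
  unfolding nonattacking_def by blast

lemma nonattacking_inj:
  assumes "nonattacking p"
  shows "inj_on fst p" "inj_on snd p"
  using assms unfolding nonattacking_def inj_on_def by fastforce+

lemma rook_sum_eq_0:
  assumes "finite I" "card I < k"
  shows "rook_sum q (row_cells I lam) k = 0"
proof -
  have "p \<notin> placements (row_cells I lam) k" for p
  proof
    assume p: "p \<in> placements (row_cells I lam) k"
    have "card p = card (fst ` p)"
      using p nonattacking_inj(1)[of p] by (simp add: placements_def card_image)
    also have "\<dots> \<le> card I"
      by (intro card_mono assms) (use p in \<open>auto simp: placements_def\<close>)
    finally show False using p assms(2) by (simp add: placements_def)
  qed
  then have "placements (row_cells I lam) k = {}" by blast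
  then show ?thesis by (simp add: rook_sum_def)
qed

text \<open>
  The rooks in the rows of \<open>I\<close> occupy different columns, and each of them cancels the cell of its
  column in the new top row \<open>i0\<close>, which is at least as long as the other rows. If there are \<open>l\<close> such
  rooks, then \<open>lam i0 - l\<close> cells of row \<open>i0\<close> remain. All of these survive if no rook is placed there,
  and the possible positions of a new rook together contribute \<open>qnum q (lam i0 - l)\<close>. The
  coefficients are written with quotients of powers of \<open>q\<close>, so that no truncated subtraction occurs;
  this is correct also for \<open>l > lam i0\<close>, when there is no placement of \<open>l\<close> rooks.
\<close>

lemma rook_sum_insert_top_row:
  fixes q :: "'a::field"
  assumes "finite I" "\<forall>i\<in>I. i0 < i" "\<forall>i\<in>I. lam i \<le> lam i0" "q \<noteq> 0" "q \<noteq> 1"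
  shows "rook_sum q (row_cells (insert i0 I) lam) k =
     q ^ lam i0 / q ^ k * rook_sum q (row_cells I lam) k +
     (case k of 0 \<Rightarrow> 0
      | Suc l \<Rightarrow> (1 - q ^ lam i0 / q ^ l) / (1 - q) * rook_sum q (row_cells I lam) l)"
proof -
  define C where "C = row_cells I lam"
  define C' where "C' = row_cells (insert i0 I) lam"
  \<comment> \<open>The columns of the top row that no rook of p has cancelled.\<close>
  define J where "J = (\<lambda>p :: (nat \<times> nat) set. {1..lam i0} - snd ` p)"
  \<comment> \<open>The placements with a rook in the top row.\<close>
  define T where "T = {p \<in> placements C' k. \<exists>j. (i0, j) \<in> p}"
  have C: "i0 < i" "1 \<le> j" "j \<le> lam i0" if "(i, j) \<in> C" for i j
    using that assms(2,3) by (auto simp: C_def intro: order.trans)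
  have C': "C' = C \<union> {i0} \<times> {1..lam i0}" by (auto simp: C_def C'_def)
  have fC: "finite C" "finite C'" using assms(1) by (auto simp: C_def C'_def)
  have fp: "finite p" if "p \<in> placements C l" for p l
    using that fC(1) by (auto simp: placements_def intro: finite_subset)
  have i0: "(i0, j) \<notin> p" if "p \<in> placements C l" for p l j
    using that C(1)[of i0 j] by (auto simp: placements_def)
  have J: "card (J p) = lam i0 - l" "l \<le> lam i0" "finite (J p)" if p: "p \<in> placements C l" for p l
  proof -
    have sub: "snd ` p \<subseteq> {1..lam i0}" using p C by (fastforce simp: placements_def)
    have card: "card (snd ` p) = l"
      using p nonattacking_inj(2)[of p] by (simp add: placements_def card_image)
    show "card (J p) = lam i0 - l" unfolding J_def
      using sub card fp[OF p] by (subst card_Diff_subset) auto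
    show "l \<le> lam i0" using card_mono[OF _ sub] card by simp
    show "finite (J p)" by (simp add: J_def)
  qed
  have fu: "finite (uncancelled C p)" for p
    by (rule finite_subset[OF _ fC(1)]) (auto simp: uncancelled_def)
  have split: "placements C' k = placements C k \<union> T"
  proof (intro equalityI subsetI)
    fix p assume p: "p \<in> placements C' k"
    show "p \<in> placements C k \<union> T"
    proof (cases "\<exists>j. (i0, j) \<in> p")
      case False
      then show ?thesis using p by (auto simp: placements_def C')
    qed (use p in \<open>simp add: T_def\<close>)
  qed (auto simp: T_def placements_def C')
  have noT: "placements C k \<inter> T = {}" using i0 by (auto simp: T_def)
  have fin: "finite (placements C l)" "finite T" for l
    using finite_placements[OF fC(1)] finite_placements[OF fC(2)] by (auto simp: T_def)
  have empty_row: "card (uncancelled C' p) = card (uncancelled C p) + (lam i0 - l)"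
    if p: "p \<in> placements C l" for p l
  proof -
    have below: "i0 < r" if "(r, s) \<in> p" for r s
      using p C that by (auto simp: placements_def)
    have "uncancelled C' p = uncancelled C p \<union> {i0} \<times> J p"
      unfolding uncancelled_def C' J_def using below by (fastforce simp: image_iff dest: less_imp_le)
    moreover have "uncancelled C p \<inter> {i0} \<times> J p = {}"
      using C by (fastforce simp: uncancelled_def)
    ultimately show ?thesis
      using J[OF p] fu by (simp add: card_Un_disjoint card_cartesian_product)
  qed
  have rook_row: "card (uncancelled C' (insert (i0, j) p)) = card (uncancelled C p) + card {x \<in> J p. j < x}"
    if p: "p \<in> placements C l" and j: "j \<in> J p" for p l j
  proof -
    have below: "i0 < r" if "(r, s) \<in> p" for r s
      using p C that by (auto simp: placements_def)
    have "uncancelled C' (insert (i0, j) p) = uncancelled C p \<union> {i0} \<times> {x \<in> J p. j < x}"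
      (is "?L = ?R")
    proof (intro equalityI subrelI)
      fix i x assume "(i, x) \<in> ?L"
      then have h: "(i, x) \<in> C'" "\<not> ((x = j \<and> i \<le> i0) \<or> (i = i0 \<and> x \<le> j))"
          "\<And>r s. (r, s) \<in> p \<Longrightarrow> \<not> ((x = s \<and> i \<le> r) \<or> (i = r \<and> x \<le> s))"
        by (auto simp: uncancelled_def)
      show "(i, x) \<in> ?R"
      proof (cases "i = i0")
        case True
        have "x \<notin> snd ` p" using h(3) below True by (force dest: less_imp_le)
        moreover have "x \<in> {1..lam i0}" using h(1) True C[of i0 x] by (auto simp: C')
        ultimately show ?thesis using True h(2) by (auto simp: J_def)
      next
        case False
        then have "(i, x) \<in> C" using h(1) by (auto simp: C')
        then have "(i, x) \<in> uncancelled C p" using h(3) by (auto simp: uncancelled_def)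
        then show ?thesis by blast
      qed
    next
      fix i x assume "(i, x) \<in> ?R"
      then consider "(i, x) \<in> uncancelled C p" | "i = i0" "x \<in> J p" "j < x" by auto
      then show "(i, x) \<in> ?L"
      proof cases
        case 1
        then have "i0 < i" using C by (auto simp: uncancelled_def)
        then show ?thesis using 1 by (auto simp: uncancelled_def C')
      next
        case 2
        then have "x \<noteq> s \<and> i0 < r" if "(r, s) \<in> p" for r s
          using that below by (force simp: J_def image_iff)
        then show ?thesis using 2 by (fastforce simp: uncancelled_def C' J_def)
      qed
    qed
    moreover have "uncancelled C p \<inter> {i0} \<times> {x \<in> J p. j < x} = {}"
      using C by (fastforce simp: uncancelled_def)
    ultimately show ?thesis
      using J[OF p] fu by (simp add: card_Un_disjoint card_cartesian_product)
  qed
  have without: "(\<Sum>p\<in>placements C k. q ^ card (uncancelled C' p)) = q ^ lam i0 / q ^ k * rook_sum q C k"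
    unfolding rook_sum_def sum_distrib_left
  proof (intro sum.cong refl)
    fix p assume p: "p \<in> placements C k"
    show "q ^ card (uncancelled C' p) = q ^ lam i0 / q ^ k * q ^ card (uncancelled C p)"
      unfolding empty_row[OF p] using J(2)[OF p] assms(4) by (simp add: power_add power_diff)
  qed
  have with_rook: "(\<Sum>p\<in>T. q ^ card (uncancelled C' p)) = (case k of 0 \<Rightarrow> 0
      | Suc l \<Rightarrow> (1 - q ^ lam i0 / q ^ l) / (1 - q) * rook_sum q C l)"
  proof (cases k)
    case 0
    have "T = {}"
    proof -
      have "p \<notin> T" for p
      proof
        assume p: "p \<in> T"
        then have "finite p" using fC(2) by (auto simp: T_def placements_def intro: finite_subset)
        then have "p = {}" using p 0 by (simp add: T_def placements_def)
        then show False using p by (simp add: T_def)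
      qed
      then show ?thesis by blast
    qed
    then show ?thesis using 0 by simp
  next
    case (Suc l)
    \<comment> \<open>Taking away the rook of the top row leaves a placement on C and recovers the position j.\<close>
    have top_rook: "\<exists>j. (i0, j) \<in> p \<and> (THE j. (i0, j) \<in> p) = j \<and> p - {i0} \<times> UNIV = p - {(i0, j)} \<and>
        p - {(i0, j)} \<in> placements C l \<and> j \<in> J (p - {(i0, j)})" if pT: "p \<in> T" for p
    proof -
      obtain j where j: "(i0, j) \<in> p" and p: "p \<in> placements C' k"
        using pT unfolding T_def by blast
      have na: "nonattacking p" and sub: "p \<subseteq> C'" and card: "card p = k"
        using p by (auto simp: placements_def)
      have uniq: "j' = j" if "(i0, j') \<in> p" for j'
        using na j that unfolding nonattacking_def by blast
      have uniq': "i = i0" if "(i, j) \<in> p" for i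
        using na j that unfolding nonattacking_def by blast
      have the: "(THE j. (i0, j) \<in> p) = j" using j uniq by (rule the_equality)
      have eq: "p - {i0} \<times> UNIV = p - {(i0, j)}" using uniq by blast
      have "card (p - {(i0, j)}) = l"
        using card Suc j by (simp add: card_Diff_singleton)
      moreover have "p - {(i0, j)} \<subseteq> C"
        using sub uniq unfolding C' by blast
      moreover have "nonattacking (p - {(i0, j)})"
        using na by (rule nonattacking_subset) blast
      moreover have "j \<in> J (p - {(i0, j)})"
      proof -
        have "(i0, j) \<in> C'" using j sub by blast
        then have "j \<in> {1..lam i0}" using C(1)[of i0 j] unfolding C' by blast
        moreover have "j \<notin> snd ` (p - {(i0, j)})" using uniq' by fastforce
        ultimately show ?thesis by (simp add: J_def)
      qed
      ultimately show ?thesis using j the eq by (auto simp: placements_def)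
    qed
    have "(\<Sum>p\<in>T. q ^ card (uncancelled C' p)) =
        (\<Sum>(p, j)\<in>(SIGMA p:placements C l. J p). q ^ card (uncancelled C p) * q ^ card {x \<in> J p. j < x})"
    proof (rule sum.reindex_bij_witness[where i = "\<lambda>(p, j). insert (i0, j) p"
          and j = "\<lambda>p. (p - {i0} \<times> UNIV, THE j. (i0, j) \<in> p)"], goal_cases)
      case (1 p)
      then show ?case using top_rook[OF 1] by (auto simp: insert_absorb)
    next
      case (2 p)
      then show ?case using top_rook[OF 2] by auto
    next
      case (3 x)
      then obtain p j where x: "x = (p, j)" "p \<in> placements C l" by auto
      have "(THE j'. (i0, j') \<in> insert (i0, j) p) = j"
        using i0[OF x(2)] by (intro the_equality) auto
      moreover have "insert (i0, j) p - {i0} \<times> UNIV = p"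
        using i0[OF x(2)] by auto
      ultimately show ?case by (simp add: x)
    next
      case (4 x)
      then obtain p j where x: "x = (p, j)" "p \<in> placements C l" "j \<in> J p" by auto
      have "nonattacking (insert (i0, j) p)"
        using x(2,3) i0[OF x(2)] by (force simp: nonattacking_def placements_def J_def)
      moreover have "card (insert (i0, j) p) = k"
        using x(2) i0[OF x(2)] fp[OF x(2)] Suc by (simp add: placements_def)
      moreover have "insert (i0, j) p \<subseteq> C'"
        using x(2,3) by (auto simp: placements_def C' J_def)
      ultimately show ?case by (auto simp: x T_def placements_def)
    next
      case (5 p)
      obtain j where j: "(i0, j) \<in> p" "(THE j. (i0, j) \<in> p) = j" "p - {i0} \<times> UNIV = p - {(i0, j)}"
          "p - {(i0, j)} \<in> placements C l" "j \<in> J (p - {(i0, j)})"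
        using top_rook[OF 5] by blast
      show ?case
        using rook_row[OF j(4,5)] j(1) unfolding j(2,3) by (simp add: insert_absorb power_add)
    qed
    also have "\<dots> = (\<Sum>p\<in>placements C l. \<Sum>j\<in>J p. q ^ card (uncancelled C p) * q ^ card {x \<in> J p. j < x})"
      using fin(1) J(3) by (intro sum.Sigma[symmetric]) auto
    also have "\<dots> = (\<Sum>p\<in>placements C l. (1 - q ^ lam i0 / q ^ l) / (1 - q) * q ^ card (uncancelled C p))"
    proof (intro sum.cong refl)
      fix p assume p: "p \<in> placements C l"
      have "(\<Sum>j\<in>J p. q ^ card (uncancelled C p) * q ^ card {x \<in> J p. j < x}) =
          q ^ card (uncancelled C p) * qnum q (lam i0 - l)"
        unfolding sum_distrib_left[symmetric] sum_power_card_greater[OF J(3)[OF p] assms(5)] J(1)[OF p] ..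
      then show "(\<Sum>j\<in>J p. q ^ card (uncancelled C p) * q ^ card {x \<in> J p. j < x}) =
          (1 - q ^ lam i0 / q ^ l) / (1 - q) * q ^ card (uncancelled C p)"
        using J(2)[OF p] assms(4) by (simp add: qnum_def power_diff)
    qed
    finally show ?thesis by (simp add: Suc rook_sum_def sum_distrib_left)
  qed
  have "rook_sum q C' k = (\<Sum>p\<in>placements C k. q ^ card (uncancelled C' p)) +
      (\<Sum>p\<in>T. q ^ card (uncancelled C' p))"
    unfolding rook_sum_def split using fin noT by (intro sum.union_disjoint)
  then show ?thesis
    unfolding without with_rook unfolding C_def C'_def .
qed

text \<open>
  The q-analogue of the factorization theorem for rook polynomials of Ferrers boards, due to
  Goldman, Joichi and White for \<open>q = 1\<close> and to Garsia and Remmel in general.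
\<close>

lemma rook_factorization:
  fixes q u :: "'a::field"
  assumes "finite I" "antimono_on I lam" "q \<noteq> 0" "q \<noteq> 1"
  shows "(\<Sum>k\<le>card I. rook_sum q (row_cells I lam) k * (1 - q) ^ k *
            (\<Prod>i=Suc k..card I. 1 - u * q ^ i)) =
         q ^ card (row_cells I lam) * (\<Prod>i\<in>I. inverse q ^ lam i - u * q ^ card {x \<in> I. x \<le> i})"
  using assms(1,2)
proof (induction I arbitrary: u rule: finite_linorder_min_induct)
  case empty
  have "placements {} 0 = {{}}" by (auto simp: placements_def nonattacking_def)
  then show ?case by (simp add: rook_sum_def uncancelled_def)
next
  case (insert i0 I)
  define N where "N = card I"
  define R where "R = rook_sum q (row_cells I lam)"
  define R' where "R' = rook_sum q (row_cells (insert i0 I) lam)"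
  define G where "G = (\<lambda>k. \<Prod>i=Suc k..N. 1 - u * q * q ^ i)"
  define H where "H = (\<lambda>k. \<Prod>i=Suc k..Suc N. 1 - u * q ^ i)"
  have i0: "i0 \<notin> I" using insert.hyps by auto
  have mono: "antimono_on I lam" and top: "\<forall>i\<in>I. lam i \<le> lam i0"
    using insert.prems insert.hyps by (auto simp: monotone_on_def less_imp_le)
  have R': "R' k = q ^ lam i0 / q ^ k * R k + (case k of 0 \<Rightarrow> 0
      | Suc l \<Rightarrow> (1 - q ^ lam i0 / q ^ l) / (1 - q) * R l)" for k
    unfolding R_def R'_def by (rule rook_sum_insert_top_row) (use insert.hyps top assms in auto)
  have RN: "R (Suc N) = 0"
    unfolding R_def using insert.hyps by (intro rook_sum_eq_0) (simp_all add: N_def)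
  \<comment> \<open>A new top row raises the rank of every other row by one, which replaces u by u * q.\<close>
  have HS: "H (Suc k) = G k" for k
    unfolding H_def G_def by (simp only: prod.shift_bounds_cl_Suc_ivl) (simp add: mult_ac)
  have H: "H k = (1 - u * q ^ Suc k) * G k" if "k \<le> N" for k
    using that HS[of k] unfolding H_def by (subst prod.atLeast_Suc_atMost) auto
  have "(\<Sum>k\<le>Suc N. R' k * (1 - q) ^ k * H k) =
        (\<Sum>k\<le>Suc N. q ^ lam i0 / q ^ k * R k * (1 - q) ^ k * H k) +
        (\<Sum>k\<le>Suc N. (case k of 0 \<Rightarrow> 0
            | Suc l \<Rightarrow> (1 - q ^ lam i0 / q ^ l) / (1 - q) * R l) * (1 - q) ^ k * H k)"
    unfolding R' by (simp add: distrib_right sum.distrib)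
  also have "(\<Sum>k\<le>Suc N. q ^ lam i0 / q ^ k * R k * (1 - q) ^ k * H k) =
       (\<Sum>k\<le>N. q ^ lam i0 / q ^ k * R k * (1 - q) ^ k * ((1 - u * q ^ Suc k) * G k))"
    using RN H by simp
  also have "(\<Sum>k\<le>Suc N. (case k of 0 \<Rightarrow> 0
            | Suc l \<Rightarrow> (1 - q ^ lam i0 / q ^ l) / (1 - q) * R l) * (1 - q) ^ k * H k) =
       (\<Sum>k\<le>N. (1 - q ^ lam i0 / q ^ k) / (1 - q) * R k * (1 - q) ^ Suc k * G k)"
    by (simp only: sum.atMost_Suc_shift HS) simp
  also have "(\<Sum>k\<le>N. q ^ lam i0 / q ^ k * R k * (1 - q) ^ k * ((1 - u * q ^ Suc k) * G k)) + \<dots> =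
      (\<Sum>k\<le>N. q ^ lam i0 * (inverse q ^ lam i0 - u * q) * (R k * (1 - q) ^ k * G k))"
    unfolding sum.distrib[symmetric]
    by (intro sum.cong refl) (use assms(3,4) in \<open>simp add: field_simps\<close>)
  also have "\<dots> = q ^ lam i0 * (inverse q ^ lam i0 - u * q) * (\<Sum>k\<le>N. R k * (1 - q) ^ k * G k)"
    by (simp only: sum_distrib_left)
  also have "(\<Sum>k\<le>N. R k * (1 - q) ^ k * G k) =
      q ^ card (row_cells I lam) * (\<Prod>i\<in>I. inverse q ^ lam i - u * q * q ^ card {x \<in> I. x \<le> i})"
    using insert.IH[OF mono, of "u * q"] unfolding R_def G_def N_def .
  finally have main: "(\<Sum>k\<le>Suc N. R' k * (1 - q) ^ k * H k) =
      q ^ (lam i0 + card (row_cells I lam)) * ((inverse q ^ lam i0 - u * q) *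
        (\<Prod>i\<in>I. inverse q ^ lam i - u * q * q ^ card {x \<in> I. x \<le> i}))"
    by (simp add: power_add mult_ac)
  have "card (row_cells (insert i0 I) lam) = lam i0 + card (row_cells I lam)"
    using insert.hyps i0 by (subst (1 2) card_SigmaI) auto
  moreover have "{x. (x = i0 \<or> x \<in> I) \<and> x \<le> i0} = {i0}" using insert.hyps by auto
  moreover have "card {x. (x = i0 \<or> x \<in> I) \<and> x \<le> i} = Suc (card {x \<in> I. x \<le> i})" if "i \<in> I" for i
  proof -
    have "{x. (x = i0 \<or> x \<in> I) \<and> x \<le> i} = insert i0 {x \<in> I. x \<le> i}"
      using that insert.hyps by auto
    then show ?thesis using insert.hyps i0 by simp
  qed
  ultimately show ?case
    using main insert.hyps i0 unfolding R'_def H_def N_def by (simp add: mult_ac cong: prod.cong)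
qed

section \<open>The q-hit numbers\<close>

lemma qfalling_Suc: "qfalling q a (Suc k) = qfalling q a k * qnum q (a - k)"
  by (simp add: qfalling_def)

lemma qfactorial_Suc: "qfactorial q (Suc k) = qnum q (Suc k) * qfactorial q k"
  unfolding qfactorial_def qfalling_def by (subst prod.lessThan_Suc_shift) simp

lemma qfactorial_eq_qfalling_mult:
  assumes "n \<le> m"
  shows "qfactorial q m = qfalling q m n * qfactorial q (m - n)"
  using assms
proof (induction n)
  case 0
  then show ?case by (simp add: qfalling_def)
next
  case (Suc n)
  then have "m - n = Suc (m - Suc n)" by simp
  then show ?case using Suc by (simp add: qfalling_Suc qfactorial_Suc)
qed

lemma qnum_neq_0:
  assumes "\<forall>k>0. q ^ k \<noteq> 1" "k > 0"
  shows "qnum q k \<noteq> 0"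
  using assms(1)[rule_format, OF assms(2)] assms(1)[rule_format, of 1] by (simp add: qnum_def)

lemma qfalling_neq_0:
  assumes "\<forall>k>0. q ^ k \<noteq> 1" "k \<le> a"
  shows "qfalling q a k \<noteq> 0"
  unfolding qfalling_def using qnum_neq_0[OF assms(1)] assms(2) by simp

lemma qpochhammer_Suc:
  "qpochhammer [:0, 1:] [:q:] (Suc i) = qpochhammer [:0, 1:] [:q:] i * [:1, - (q ^ i):]"
  for q :: "'a::field"
proof -
  have "1 - [:0, 1:] * [:q:] ^ i = [:1, - (q ^ i):]"
    by (simp add: poly_const_pow one_pCons)
  then show ?thesis by (simp add: qpochhammer_def)
qed

lemma coeff_qpochhammer_Suc:
  "coeff (qpochhammer [:0, 1:] [:q:] (Suc i)) j =
     coeff (qpochhammer [:0, 1:] [:q:] i) j -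
       q ^ i * (case j of 0 \<Rightarrow> 0 | Suc l \<Rightarrow> coeff (qpochhammer [:0, 1:] [:q:] i) l)"
  for q :: "'a::field"
  unfolding qpochhammer_Suc by (simp add: coeff_pCons split: nat.split)

lemma coeff_qpochhammer_eq_0:
  "i < j \<Longrightarrow> coeff (qpochhammer [:0, 1:] [:q:] i) j = 0" for q :: "'a::field"
proof (induction i arbitrary: j)
  case 0
  then show ?case by (simp add: qpochhammer_def)
next
  case (Suc i)
  then show ?case by (auto simp: coeff_qpochhammer_Suc split: nat.split)
qed

text \<open>
  The linear map that sends \<open>x^j\<close> to \<open>(\<Prod>l=1..j. v - u q^l) (\<Prod>l=j+1..i. 1 - u q^l)\<close>, applied to
  \<open>(x;q)\<^sub>i\<close>. The result does not depend on \<open>u\<close>. The induction uses this: multiplication by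
  \<open>1 - x q^i\<close> leads to a combination of the values at \<open>u\<close> and at \<open>u q\<close>.
\<close>

lemma qpochhammer_evaluation:
  fixes q u v :: "'a::field"
  shows "(\<Sum>j\<le>i. coeff (qpochhammer [:0, 1:] [:q:] i) j *
            ((\<Prod>l=1..j. v - u * q ^ l) * (\<Prod>l=Suc j..i. 1 - u * q ^ l))) =
         (\<Prod>s<i. 1 - v * q ^ s)"
proof (induction i arbitrary: u)
  case 0
  then show ?case by (simp add: qpochhammer_def)
next
  case (Suc i)
  define c where "c = coeff (qpochhammer [:0, 1:] [:q:] i)"
  define P where "P = (\<lambda>u j. (\<Prod>l=1..j. v - u * q ^ l) * (\<Prod>l=Suc j..i. 1 - u * q ^ l))"
  define P' where "P' = (\<lambda>j. (\<Prod>l=1..j. v - u * q ^ l) * (\<Prod>l=Suc j..Suc i. 1 - u * q ^ l))"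
  define X where "X = (\<Prod>s<i. 1 - v * q ^ s)"
  have P'1: "P' j = (1 - u * q ^ Suc i) * P u j" if "j \<le> i" for j
    using that unfolding P_def P'_def by (simp add: mult_ac)
  have P'2: "P' (Suc j) = (v - u * q) * P (u * q) j" for j
  proof -
    have "(\<Prod>l=1..Suc j. v - u * q ^ l) = (v - u * q) * (\<Prod>l=1..j. v - u * q * q ^ l)"
      by (subst prod.atLeast_Suc_atMost, simp, simp only: prod.shift_bounds_cl_Suc_ivl One_nat_def)
        (simp add: mult_ac)
    moreover have "(\<Prod>l=Suc (Suc j)..Suc i. 1 - u * q ^ l) = (\<Prod>l=Suc j..i. 1 - u * q * q ^ l)"
      by (simp only: prod.shift_bounds_cl_Suc_ivl) (simp add: mult_ac)
    ultimately show ?thesis by (simp add: P_def P'_def mult_ac)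
  qed
  have cS: "c (Suc i) = 0" unfolding c_def by (rule coeff_qpochhammer_eq_0) simp
  have IH: "(\<Sum>j\<le>i. c j * P w j) = X" for w
    using Suc.IH[of w] unfolding c_def P_def X_def .
  have "(\<Sum>j\<le>Suc i. coeff (qpochhammer [:0, 1:] [:q:] (Suc i)) j * P' j) =
      (\<Sum>j\<le>Suc i. c j * P' j) - (\<Sum>j\<le>Suc i. q ^ i * (case j of 0 \<Rightarrow> 0 | Suc l \<Rightarrow> c l) * P' j)"
    unfolding coeff_qpochhammer_Suc c_def by (simp only: left_diff_distrib sum_subtractf)
  also have "(\<Sum>j\<le>Suc i. c j * P' j) = (\<Sum>j\<le>i. c j * ((1 - u * q ^ Suc i) * P u j))"
    by (simp add: cS P'1)
  also have "\<dots> = (1 - u * q ^ Suc i) * X"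
    unfolding IH[of u, symmetric] sum_distrib_left by (simp only: mult_ac)
  also have "(\<Sum>j\<le>Suc i. q ^ i * (case j of 0 \<Rightarrow> 0 | Suc l \<Rightarrow> c l) * P' j) =
      (\<Sum>j\<le>i. q ^ i * c j * ((v - u * q) * P (u * q) j))"
    by (simp only: sum.atMost_Suc_shift P'2) simp
  also have "\<dots> = q ^ i * (v - u * q) * X"
    unfolding IH[of "u * q", symmetric] sum_distrib_left by (simp only: mult_ac)
  also have "(1 - u * q ^ Suc i) * X - q ^ i * (v - u * q) * X = (\<Prod>s<Suc i. 1 - v * q ^ s)"
    by (simp add: X_def algebra_simps)
  finally show ?case unfolding P'_def .
qed

lemma qpochhammer_evaluation_board:
  fixes q u v :: "'a::field"
  assumes "i \<le> n"
  shows "(\<Sum>j\<le>n. coeff (qpochhammer [:0, 1:] [:q:] i) j *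
            ((\<Prod>l=1..j. v - u * q ^ l) * (\<Prod>l=Suc j..n. 1 - u * q ^ l))) =
         (\<Prod>s<i. 1 - v * q ^ s) * (\<Prod>l=Suc i..n. 1 - u * q ^ l)"
proof -
  have split: "(\<Prod>l=Suc j..n. 1 - u * q ^ l) =
      (\<Prod>l=Suc j..i. 1 - u * q ^ l) * (\<Prod>l=Suc i..n. 1 - u * q ^ l)" if "j \<le> i" for j
  proof -
    have "{Suc j..n} = {Suc j..i} \<union> {Suc i..n}" using that assms by auto
    then show ?thesis by (simp add: prod.union_disjoint)
  qed
  have "(\<Sum>j\<le>n. coeff (qpochhammer [:0, 1:] [:q:] i) j *
            ((\<Prod>l=1..j. v - u * q ^ l) * (\<Prod>l=Suc j..n. 1 - u * q ^ l))) =
        (\<Sum>j\<le>i. coeff (qpochhammer [:0, 1:] [:q:] i) j *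
            ((\<Prod>l=1..j. v - u * q ^ l) * (\<Prod>l=Suc j..n. 1 - u * q ^ l)))"
    using assms by (intro sum.mono_neutral_right) (auto simp: coeff_qpochhammer_eq_0)
  also have "\<dots> = (\<Sum>j\<le>i. coeff (qpochhammer [:0, 1:] [:q:] i) j *
            ((\<Prod>l=1..j. v - u * q ^ l) * (\<Prod>l=Suc j..i. 1 - u * q ^ l)) *
             (\<Prod>l=Suc i..n. 1 - u * q ^ l))"
  proof (intro sum.cong refl, goal_cases)
    case (1 j)
    then have "j \<le> i" by simp
    show ?case unfolding split[OF \<open>j \<le> i\<close>] by (simp only: mult_ac)
  qed
  finally show ?thesis
    unfolding sum_distrib_right[symmetric] qpochhammer_evaluation .
qed

text \<open>
  The weight of \<open>R\<^sub>i(\<lambda>) (x;q)\<^sub>i\<close> in the generating polynomial of the q-hit numbers cancels the value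
  of the product from \<open>qpochhammer_evaluation\<close> at \<open>v = q^(-m)\<close>.
\<close>

lemma qfactorial_mult_prod:
  fixes q :: "'a::field"
  assumes "q \<noteq> 0" "\<forall>k>0. q ^ k \<noteq> 1" "i \<le> m"
  shows "qfactorial q (m - i) * (- 1) ^ i * q powi (int (m * i) - int (i choose 2)) *
           (\<Prod>s<i. 1 - inverse q ^ m * q ^ s) = qfactorial q m * (1 - q) ^ i"
  using assms(3)
proof (induction i)
  case 0
  then show ?case by (simp add: numeral_2_eq_2)
next
  case (Suc i)
  define e where "e = int (m * i) - int (i choose 2)"
  define X where "X = (\<Prod>s<i. 1 - inverse q ^ m * q ^ s)"
  have q1: "q \<noteq> 1" using spec[OF assms(2), of 1] by auto
  have "int (m * Suc i) - int (Suc i choose 2) = e + int (m - i)"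
    using Suc.prems by (simp add: e_def numeral_2_eq_2 of_nat_diff algebra_simps)
  then have pow: "q powi (int (m * Suc i) - int (Suc i choose 2)) = q powi e * q ^ (m - i)"
    using assms(1) by (simp add: power_int_add)
  have fact: "qfactorial q (m - i) = qnum q (m - i) * qfactorial q (m - Suc i)"
    using Suc.prems qfactorial_Suc[of q "m - Suc i"] by (simp add: Suc_diff_Suc)
  have "q ^ (m - i) * (1 - inverse q ^ m * q ^ i) = - (1 - q ^ (m - i))"
    using assms(1) Suc.prems by (simp add: power_diff field_simps)
  also have "1 - q ^ (m - i) = qnum q (m - i) * (1 - q)"
    using q1 by (simp add: qnum_def)
  finally have last: "q ^ (m - i) * (1 - inverse q ^ m * q ^ i) = - (qnum q (m - i) * (1 - q))" .
  have "qfactorial q (m - Suc i) * (- 1) ^ Suc i * (q powi e * q ^ (m - i)) * (X * (1 - inverse q ^ m * q ^ i)) =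
     qfactorial q (m - Suc i) * (- 1) ^ Suc i * q powi e * X * (q ^ (m - i) * (1 - inverse q ^ m * q ^ i))"
    by (simp only: mult_ac)
  also have "\<dots> = (1 - q) * (qfactorial q (m - i) * (- 1) ^ i * q powi e * X)"
    unfolding last fact by simp
  also have "\<dots> = qfactorial q m * (1 - q) ^ Suc i"
    using Suc.IH Suc.prems unfolding X_def e_def by simp
  finally show ?case unfolding pow X_def by simp
qed

text \<open>
  The products are the board polynomials of \<open>\<lambda>\<close> and of the rectangles \<open>m^j\<close>.
\<close>

lemma sum_qhit_rectangles:
  fixes q u :: "'a::field"
  assumes "q \<noteq> 0" "\<forall>k>0. q ^ k \<noteq> 1" "n \<le> m" "partition_in_board m n lam"
  shows "(\<Sum>j=0..n. qhit q m n lam j * (\<Prod>i=1..n. inverse q ^ rectangle m j i - u * q ^ i)) =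
     qfalling q m n * (\<Prod>i=1..n. inverse q ^ lam i - u * q ^ i)"
proof -
  have q1: "q \<noteq> 1" using spec[OF assms(2), of 1] by auto
  define b where "b = (\<lambda>j. (\<Prod>l=1..j. inverse q ^ m - u * q ^ l) * (\<Prod>l=Suc j..n. 1 - u * q ^ l))"
  define c where "c = (\<lambda>i j. coeff (qpochhammer [:0, 1:] [:q:] i) j)"
  define K where "K = (\<lambda>i. qrook q n lam i * qfactorial q (m - i) * (- 1) ^ i *
                 q powi (int (m * i) - int (i choose 2)))"
  define pre where "pre = q powi (- int (card (cells n lam))) / qfactorial q (m - n)"
  \<comment> \<open>A row of length m contributes a factor of the first product, an empty row one of the second.\<close>
  have rect: "(\<Prod>i=1..n. inverse q ^ rectangle m j i - u * q ^ i) = b j" if "j \<le> n" for j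
  proof -
    have "{1..n} = {1..j} \<union> {Suc j..n}" using that by auto
    then show ?thesis
      by (simp add: prod.union_disjoint b_def rectangle_def)
  qed
  have hit: "qhit q m n lam j = pre * (\<Sum>i\<le>n. K i * c i j)" for j
    by (simp add: qhit_def qhit_poly_def pre_def K_def c_def coeff_sum atMost_atLeast0)
  have "(\<Sum>j=0..n. qhit q m n lam j * (\<Prod>i=1..n. inverse q ^ rectangle m j i - u * q ^ i)) =
      (\<Sum>j\<le>n. \<Sum>i\<le>n. pre * (K i * (c i j * b j)))"
    unfolding atMost_atLeast0[symmetric]
    by (intro sum.cong refl) (simp add: rect[unfolded One_nat_def] hit sum_distrib_left sum_distrib_right mult_ac)
  also have "\<dots> = pre * (\<Sum>i\<le>n. K i * (\<Sum>j\<le>n. c i j * b j))"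
    by (subst sum.swap) (simp add: sum_distrib_left)
  also have "(\<Sum>i\<le>n. K i * (\<Sum>j\<le>n. c i j * b j)) =
      (\<Sum>i\<le>n. qfactorial q m * (qrook q n lam i * (1 - q) ^ i * (\<Prod>l=Suc i..n. 1 - u * q ^ l)))"
  proof (intro sum.cong refl)
    fix i assume "i \<in> {..n}"
    then have i: "i \<le> n" "i \<le> m" using assms(3) by auto
    have "K i * (\<Sum>j\<le>n. c i j * b j) = qrook q n lam i * (qfactorial q (m - i) * (- 1) ^ i *
          q powi (int (m * i) - int (i choose 2)) * (\<Prod>s<i. 1 - inverse q ^ m * q ^ s)) *
          (\<Prod>l=Suc i..n. 1 - u * q ^ l)"
      unfolding c_def b_def qpochhammer_evaluation_board[OF i(1)] K_def by (simp only: mult_ac)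
    then show "K i * (\<Sum>j\<le>n. c i j * b j) =
        qfactorial q m * (qrook q n lam i * (1 - q) ^ i * (\<Prod>l=Suc i..n. 1 - u * q ^ l))"
      unfolding qfactorial_mult_prod[OF assms(1,2) i(2)] by (simp only: mult_ac)
  qed
  also have "\<dots> = qfactorial q m * (\<Sum>i\<le>n. qrook q n lam i * (1 - q) ^ i * (\<Prod>l=Suc i..n. 1 - u * q ^ l))"
    by (simp only: sum_distrib_left)
  also have "(\<Sum>i\<le>n. qrook q n lam i * (1 - q) ^ i * (\<Prod>l=Suc i..n. 1 - u * q ^ l)) =
      q ^ card (cells n lam) * (\<Prod>i=1..n. inverse q ^ lam i - u * q ^ i)"
  proof -
    have anti: "antimono_on {1..n} lam"
      using assms(4) by (auto simp: partition_in_board_def monotone_on_def)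
    have "card {x \<in> {1..n}. x \<le> i} = i" if "i \<in> {1..n}" for i
    proof -
      have "{x \<in> {1..n}. x \<le> i} = {1..i}" using that by auto
      then show ?thesis by simp
    qed
    then have rank: "(\<Prod>i=1..n. inverse q ^ lam i - u * q ^ card {x \<in> {1..n}. x \<le> i}) =
        (\<Prod>i=1..n. inverse q ^ lam i - u * q ^ i)"
      by (intro prod.cong refl) (simp only:)
    have card: "card {1..n} = n" by simp
    show ?thesis
      using rook_factorization[OF _ anti assms(1) q1, of u]
      unfolding rank card qrook_eq_rook_sum cells_eq_row_cells by simp
  qed
  also have "pre * (qfactorial q m * (q ^ card (cells n lam) * (\<Prod>i=1..n. inverse q ^ lam i - u * q ^ i))) =
      qfalling q m n * (\<Prod>i=1..n. inverse q ^ lam i - u * q ^ i)"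
  proof -
    have "qfactorial q (m - n) \<noteq> 0"
      unfolding qfactorial_def using assms(2) by (intro qfalling_neq_0) auto
    then show ?thesis
      using assms(1) by (simp add: pre_def qfactorial_eq_qfalling_mult[OF assms(3)] power_int_minus)
  qed
  finally show ?thesis .
qed

section \<open>The expansion into rectangles\<close>

lemma chromatic_qsym_eq_coloring_sum:
  "chromatic_qsym q m n lam M =
     coloring_sum q (two_cliques m (\<lambda>b. lam (m + n + 1 - b))) ({1..m} \<union> {m+1..m+n}) M"
proof -
  define E where "E = two_cliques m (\<lambda>b. lam (m + n + 1 - b))"
  have V: "{1..m} \<union> {m+1..m+n} = {1..m+n}" by auto
  have E: "graph_edges m n lam = {(a, b) \<in> E. a \<in> {1..m+n} \<and> b \<in> {1..m+n}}"
    by (auto simp: graph_edges_def E_def two_cliques_def)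
  have "{\<kappa>. \<kappa> \<in> proper_colorings m n lam \<and> coloring_monomial m n \<kappa> = M} = colorings E {1..m+n} M"
    by (auto simp: proper_colorings_def coloring_monomial_def colorings_def E)
  moreover have "asc m n lam \<kappa> = card (ascents E {1..m+n} \<kappa>)" for \<kappa>
    by (auto simp: asc_def ascents_def E intro!: arg_cong[of _ _ card])
  ultimately show ?thesis
    unfolding chromatic_qsym_def coloring_sum_def V E_def by simp
qed

text \<open>
  Row \<open>i\<close> of the partition is the vertex \<open>m + n + 1 - i\<close> of the graph.
\<close>

lemma board_prod_partition:
  assumes "partition_in_board m n lam"
  shows "board_prod q {1..m} {m+1..m+n} (\<lambda>b. lam (m + n + 1 - b)) u =
     (\<Prod>i=1..n. inverse q ^ lam i - u * q ^ i)"
  unfolding board_prod_def mix_prod_def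
proof (rule prod.reindex_bij_witness[where i = "\<lambda>i. m + n + 1 - i" and j = "\<lambda>b. m + n + 1 - b"], goal_cases)
  case (5 b)
  define i where "i = m + n + 1 - b"
  have i: "i \<in> {1..n}" "m + n + 1 - b = i" using 5 by (auto simp: i_def)
  then have "lam i \<le> m" using assms by (auto simp: partition_in_board_def)
  then have "{a \<in> {1..m}. a \<le> lam i} = {1..lam i}" by auto
  moreover have "{x \<in> {m+1..m+n}. b \<le> x} = {b..m+n}" using 5 by auto
  ultimately show ?case using i 5 by simp
qed auto

text \<open>
  The expansion holds over every field, for every \<open>q\<close> that is neither zero nor a root of unity.
\<close>

theorem chromatic_qsym_expansion:
  fixes q :: "'a::field"
  assumes "q \<noteq> 0" "\<forall>k>0. q ^ k \<noteq> 1" "n \<le> m" "partition_in_board m n lam"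
  shows "chromatic_qsym q m n lam M = 1 / qfalling q m n *
      (\<Sum>j = 0..n. qhit q m n lam j * chromatic_qsym q m n (rectangle m j) M)"
proof -
  have q1: "q \<noteq> 1" using spec[OF assms(2), of 1] by auto
  define P where "P = (\<lambda>lam t. \<Prod>i=1..n. inverse q ^ lam i - 1 / q ^ t * q ^ i)"
  obtain L where L: "linear_functional L" and chi: "\<And>A B \<mu>. finite A \<Longrightarrow> finite B \<Longrightarrow> A \<subseteq> {..m} \<Longrightarrow>
        B \<subseteq> {m<..} \<Longrightarrow> card A = m \<Longrightarrow> card B = n \<Longrightarrow> mono_on B \<mu> \<Longrightarrow>
      coloring_sum q (two_cliques m \<mu>) (A \<union> B) M = L (\<lambda>t. board_prod q A B \<mu> (1 / q ^ t))"
    using coloring_sum_linear_in_board_prod[OF assms(1) q1, of m m n M] by blast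
  have X: "chromatic_qsym q m n \<nu> M = L (P \<nu>)" if "partition_in_board m n \<nu>" for \<nu>
  proof -
    have "mono_on {m+1..m+n} (\<lambda>b. \<nu> (m + n + 1 - b))"
    proof (rule monotone_onI)
      fix b b' assume "b \<in> {m+1..m+n}" "b' \<in> {m+1..m+n}" "b \<le> b'"
      then have "m + n + 1 - b' \<in> {1..n}" "m + n + 1 - b \<in> {1..n}" "m + n + 1 - b' \<le> m + n + 1 - b"
        by auto
      then show "\<nu> (m + n + 1 - b) \<le> \<nu> (m + n + 1 - b')"
        using that unfolding partition_in_board_def by blast
    qed
    then have "chromatic_qsym q m n \<nu> M =
        L (\<lambda>t. board_prod q {1..m} {m+1..m+n} (\<lambda>b. \<nu> (m + n + 1 - b)) (1 / q ^ t))"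
      unfolding chromatic_qsym_eq_coloring_sum by (intro chi) auto
    then show ?thesis
      unfolding board_prod_partition[OF that] P_def .
  qed
  have rect: "partition_in_board m n (rectangle m j)" for j
    by (auto simp: partition_in_board_def rectangle_def)
  have f0: "qfalling q m n \<noteq> 0" using assms(2,3) by (intro qfalling_neq_0)
  have "P lam = (\<lambda>t. \<Sum>j = 0..n. (1 / qfalling q m n * qhit q m n lam j) * P (rectangle m j) t)"
  proof
    fix t
    show "P lam t = (\<Sum>j = 0..n. (1 / qfalling q m n * qhit q m n lam j) * P (rectangle m j) t)"
      using sum_qhit_rectangles[OF assms, of "1 / q ^ t"] f0
      unfolding P_def mult.assoc sum_distrib_left[symmetric] by simp
  qed
  then have "L (P lam) = (\<Sum>j = 0..n. (1 / qfalling q m n * qhit q m n lam j) * L (P (rectangle m j)))"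
    by (simp only: linear_functional_sum[OF L])
  then show ?thesis
    unfolding X[OF assms(4)] X[OF rect] mult.assoc sum_distrib_left[symmetric] .
qed

lemma qvar_power: "qvar ^ k = to_fract (monom 1 k)"
proof (induction k)
  case (Suc k)
  then show ?case
    unfolding power_Suc by (simp add: qvar_def monom_Suc flip: to_fract_mult)
qed simp

lemma qvar_power_neq_1: "\<forall>k>0. qvar ^ k \<noteq> 1"
proof (intro allI impI notI)
  fix k :: nat
  assume "k > 0" "qvar ^ k = 1"
  then have "monom 1 k = (1 :: rat poly)"
    unfolding qvar_power by (metis to_fract_1 to_fract_eq_iff)
  with \<open>k > 0\<close> show False by (simp add: monom_eq_1_iff)
qed

theorem theorem1p3:
  fixes m n :: nat and lam :: "nat \<Rightarrow> nat"
  assumes "m \<ge> n"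
    and "partition_in_board m n lam"
  shows "chromatic_qsym qvar m n lam =
    (\<lambda>M. 1 / qfalling qvar m n *
      (\<Sum>j = 0..n. qhit qvar m n lam j * chromatic_qsym qvar m n (rectangle m j) M))"
proof -
  have "qvar \<noteq> 0" by (simp add: qvar_def)
  then show ?thesis
    using chromatic_qsym_expansion[OF _ qvar_power_neq_1 assms] by blast
qed

end
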